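(* Let $\alpha$ be an ordinal. There is no sequence $\langle E_n : n<\omega\rangle$ of extenders such that for every $n$, $j_{E_n}$ is discontinuous at $\alpha$ (i.e. $\sup j_{E_n}[\alpha]<j_{E_n}(\alpha)$) and $E_{n+1}\mathrel{I}E_n$. That is, the internal relation is wellfounded on the class of extenders discontinuous at $\alpha$.
   Context: For an extender $E$, $j_E:V\to M_E$ is its ultrapower embedding. The internal relation is defined on extenders by $E\mathrel{I}F$ iff $j_E\restriction x\in M_F$ for every set $x\in M_F$.
   Formalization: The sup of j_E[α] is taken as the least ordinal strictly above all its elements; with the ordinary supremum every embedding, even the identity, is discontinuous at successor α and the claim fails (e.g. α = 1). At 0 and limit α nothing changes. *)

theory Defs
  imports "HOL-Library.Ramsey"
begin

(* The universe V is a type whose elements are the sets, with HOL sets and functions over the type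
   in the role of classes: Separation and Replacement range over arbitrary HOL predicates and
   functions. Consequently a HOL set of sets is an element of V as soon as it is contained in some
   "elts x", and every HOL sequence "nat => 'v" is coded by an element of V. *)

class zfc_universe =
  fixes elts :: "'a \<Rightarrow> 'a set"
  assumes extensionality: "elts x = elts y \<Longrightarrow> x = y"
    and foundation: "elts x \<noteq> {} \<Longrightarrow> \<exists>y\<in>elts x. elts y \<inter> elts x = {}"
    and pairing: "\<exists>z. elts z = {x, y}"
    and union: "\<exists>u. elts u = (\<Union>y\<in>elts x. elts y)"
    and powerset: "\<exists>p. elts p = {y. elts y \<subseteq> elts x}"
    and infinity: "\<exists>w. (\<exists>e\<in>elts w. elts e = {}) \<and>
                       (\<forall>y\<in>elts w. \<exists>z\<in>elts w. elts z = insert y (elts y))"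
    and separation: "\<exists>s. elts s = {y \<in> elts x. P y}"
    and replacement: "\<exists>r. elts r = F ` elts x"
    and choice: "\<lbrakk>\<forall>y\<in>elts x. elts y \<noteq> {};
                  \<forall>y\<in>elts x. \<forall>z\<in>elts x. y \<noteq> z \<longrightarrow> elts y \<inter> elts z = {}\<rbrakk>
                 \<Longrightarrow> \<exists>c. \<forall>y\<in>elts x. \<exists>!z. z \<in> elts c \<and> z \<in> elts y"

(* Meaningful only when A is the extension of a set. *)
definition vset :: "'v::zfc_universe set \<Rightarrow> 'v"
  where "vset A = (THE x. elts x = A)"

definition kpair :: "'v::zfc_universe \<Rightarrow> 'v \<Rightarrow> 'v"
  where "kpair x y = vset {vset {x}, vset {x, y}}"

definition transitive :: "'v::zfc_universe \<Rightarrow> bool"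
  where "transitive x \<longleftrightarrow> (\<forall>y\<in>elts x. elts y \<subseteq> elts x)"

definition ordinal :: "'v::zfc_universe \<Rightarrow> bool"
  where "ordinal x \<longleftrightarrow> transitive x \<and> (\<forall>y\<in>elts x. transitive y)"

definition ultrafilter_on :: "'b set \<Rightarrow> 'b set set \<Rightarrow> bool"
  where "ultrafilter_on I U \<longleftrightarrow>
    U \<subseteq> Pow I \<and> I \<in> U \<and> {} \<notin> U \<and>
    (\<forall>X\<in>U. \<forall>Y. X \<subseteq> Y \<and> Y \<subseteq> I \<longrightarrow> Y \<in> U) \<and>
    (\<forall>X\<in>U. \<forall>Y\<in>U. X \<inter> Y \<in> U) \<and>
    (\<forall>X. X \<subseteq> I \<longrightarrow> X \<in> U \<or> I - X \<in> U)"

(* A system (E_a : a a finite subset of ext_len E), where E_a = ext_meas E a is a family of subsets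
   of [ext_space E]^|a|. Values of ext_meas E at other arguments are irrelevant. *)
record 'v ext_system =
  ext_len :: 'v
  ext_space :: 'v
  ext_meas :: "'v set \<Rightarrow> 'v set set set"

(* The projection [zeta]^|b| -> [zeta]^|a| for a \<subseteq> b: if a consists of the elements of b with
   positions i_0 < ... < i_k in the increasing enumeration of b, then proj b a s consists of the
   elements of s with these positions. The position of x in a finite set b of ordinals is
   card (b \<inter> elts x). *)
definition proj :: "'v::zfc_universe set \<Rightarrow> 'v set \<Rightarrow> 'v set \<Rightarrow> 'v set"
  where "proj b a s = {t \<in> s. \<exists>x\<in>a. card (b \<inter> elts x) = card (s \<inter> elts t)}"

(* A pair (a, f), with f considered on [zeta]^|a| only, represents the element [a, f] of the
   ultrapower. *)
definition ult_reps :: "('v::zfc_universe) ext_system \<Rightarrow> ('v set \<times> ('v set \<Rightarrow> 'v)) set"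
  where "ult_reps E = Fpow (elts (ext_len E)) \<times> UNIV"

definition ult_mem ::
    "('v::zfc_universe) ext_system \<Rightarrow> 'v set \<times> ('v set \<Rightarrow> 'v) \<Rightarrow> 'v set \<times> ('v set \<Rightarrow> 'v) \<Rightarrow> bool"
  where "ult_mem E p q \<longleftrightarrow> p \<in> ult_reps E \<and> q \<in> ult_reps E \<and>
    (case (p, q) of ((a, f), (b, g)) \<Rightarrow>
      {s \<in> [elts (ext_space E)]\<^bsup>card (a \<union> b)\<^esup>.
          f (proj (a \<union> b) a s) \<in> elts (g (proj (a \<union> b) b s))} \<in> ext_meas E (a \<union> b))"

(* Extenders, short or long: systems of ultrafilters satisfying coherence, normality and
   wellfoundedness of the ultrapower. In the normality clause, "\<exists>t\<in>s. f s \<in> elts t" says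
   f s < max s. If the embedding is nontrivial with critical point kappa, then kappa-completeness
   of all E_a and failure of kappa^+-completeness of some E_a follow from these clauses. The ordinal
   ext_space E is not required to be the least possible one; its choice does not affect the
   ultrapower. *)
definition extender :: "('v::zfc_universe) ext_system \<Rightarrow> bool"
  where "extender E \<longleftrightarrow>
    ordinal (ext_len E) \<and> ordinal (ext_space E) \<and>
    (\<forall>a\<in>Fpow (elts (ext_len E)).
        ultrafilter_on ([elts (ext_space E)]\<^bsup>card a\<^esup>) (ext_meas E a)) \<and>
    (\<forall>a\<in>Fpow (elts (ext_len E)). \<forall>b\<in>Fpow (elts (ext_len E)). a \<subseteq> b \<longrightarrow>
        (\<forall>X. X \<subseteq> [elts (ext_space E)]\<^bsup>card a\<^esup> \<longrightarrow>
           (X \<in> ext_meas E a \<longleftrightarrow>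
            {s \<in> [elts (ext_space E)]\<^bsup>card b\<^esup>. proj b a s \<in> X} \<in> ext_meas E b))) \<and>
    (\<forall>a\<in>Fpow (elts (ext_len E)). \<forall>f.
        {s \<in> [elts (ext_space E)]\<^bsup>card a\<^esup>. \<exists>t\<in>s. f s \<in> elts t} \<in> ext_meas E a \<longrightarrow>
        (\<exists>b\<in>Fpow (elts (ext_len E)). a \<subseteq> b \<and>
           {s \<in> [elts (ext_space E)]\<^bsup>card b\<^esup>. f (proj b a s) \<in> s} \<in> ext_meas E b)) \<and>
    wfp (ult_mem E)"

(* Mostowski collapse of the ultrapower, defined directly on representatives: two representatives
   of the same element have the same ult_mem-predecessors, hence the same value. *)
definition ult_collapse :: "('v::zfc_universe) ext_system \<Rightarrow> 'v set \<times> ('v set \<Rightarrow> 'v) \<Rightarrow> 'v"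
  where "ult_collapse E =
    wfrec {(p, q). ult_mem E p q} (\<lambda>c q. vset (c ` {p. ult_mem E p q}))"

(* The transitive class M_E. *)
definition ult :: "('v::zfc_universe) ext_system \<Rightarrow> 'v set"
  where "ult E = ult_collapse E ` ult_reps E"

(* The embedding j_E : V -> M_E. *)
definition ult_emb :: "('v::zfc_universe) ext_system \<Rightarrow> 'v \<Rightarrow> 'v"
  where "ult_emb E x = ult_collapse E ({}, \<lambda>_. x)"

definition ult_emb_restrict :: "('v::zfc_universe) ext_system \<Rightarrow> 'v \<Rightarrow> 'v"
  where "ult_emb_restrict E x = vset ((\<lambda>y. kpair y (ult_emb E y)) ` elts x)"

definition internal :: "('v::zfc_universe) ext_system \<Rightarrow> 'v ext_system \<Rightarrow> bool"
  where "internal E F \<longleftrightarrow> (\<forall>x\<in>ult F. ult_emb_restrict E x \<in> ult F)"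

(* The supremum of j_E[alpha] as the least ordinal greater than all of its elements, i.e. the union
   of the successors j_E(xi) + 1 for xi < alpha. At limit alpha this is the least upper bound. At
   successors the least upper bound would make every embedding, even the identity, discontinuous. *)
definition sup_image :: "('v::zfc_universe) ext_system \<Rightarrow> 'v \<Rightarrow> 'v"
  where "sup_image E \<alpha> = vset (\<Union>\<xi>\<in>elts \<alpha>. insert (ult_emb E \<xi>) (elts (ult_emb E \<xi>)))"

definition discontinuous_at :: "('v::zfc_universe) ext_system \<Rightarrow> 'v \<Rightarrow> bool"
  where "discontinuous_at E \<alpha> \<longleftrightarrow> sup_image E \<alpha> \<in> elts (ult_emb E \<alpha>)"

end

(* Proof idea. Let j_n be the embedding of E_n and M_n its ultrapower. For E = E_(n+1) and F = E_n,
   the restriction R of j_E to a large set of M_F lies in M_F, and so does y = j_E(j_F)(s) for every s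
   in M_E that j_E(j_F) can be applied to. In M_F, the pair (R, y) defines an ultrafilter containing
   j_F(A) whenever s is in j_E(A). If s comes with an ordinal e(s) < j_E(alpha), then
   j_E(j_F)(e(s)) < j_E(sup j_F[alpha]), because sup j_F[alpha] bounds j_F(xi) for all xi < alpha.
   Choosing the ordinal sup j_n[alpha] < j_n(alpha) at each level and representing everything by
   functions, a point of E_0 yields a point of E_1 with smaller associated ordinal, then a point of
   E_2, and so on, a descending sequence of ordinals.

   The finite support representing the y of level n depends on the support chosen at level n+1, so
   that no finite supports work for all levels at once. At each level we therefore use an increasing
   sequence of supports, where the k-th approximation looks k levels ahead, and points are replaced by
   threads through these supports. The wellfoundedness of the ultrapower provides threads, and the
   corresponding completeness property of R holds almost everywhere along F. *)

theory Submission
  imports Defs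
begin

section \<open>Sets and ordinals\<close>

text \<open>HOL sets over the universe are classes; the small ones are extensions of sets. As
  \<open>vset\<close> is a definite description, smallness has to be known before
  \<open>elts (vset A) = A\<close> can be used.\<close>

definition small :: "'v::zfc_universe set \<Rightarrow> bool"
  where "small A \<longleftrightarrow> (\<exists>x. elts x = A)"

lemma small_elts [simp]: "small (elts x)"
  by (auto simp: small_def)

lemma vset_elts [simp]: "vset (elts x) = x"
  unfolding vset_def by (rule the_equality) (auto intro: extensionality)

lemma elts_vset [simp]: "small A \<Longrightarrow> elts (vset A) = A"
  by (auto simp: small_def)

lemma smallI: "elts x = A \<Longrightarrow> small A"
  unfolding small_def by blast

lemma small_subset:
  assumes "small B" "A \<subseteq> B" shows "small A"
proof -
  obtain x where x: "elts x = B" using assms(1) unfolding small_def by blast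
  have "{y \<in> elts x. y \<in> A} = A" unfolding x using assms(2) by blast
  then show ?thesis using separation[of x "\<lambda>y. y \<in> A"] unfolding small_def by simp
qed

lemma small_image:
  fixes F :: "'v::zfc_universe \<Rightarrow> 'v"
  assumes "small A" shows "small (F ` A)"
proof -
  obtain x where x: "elts x = A" using assms unfolding small_def by blast
  show ?thesis unfolding small_def x[symmetric] by (rule replacement)
qed

lemma small_UN:
  fixes B :: "'v::zfc_universe \<Rightarrow> 'v set"
  assumes "small A" "\<And>x. x \<in> A \<Longrightarrow> small (B x)" shows "small (\<Union>x\<in>A. B x)"
proof -
  obtain a where a: "elts a = (\<lambda>x. vset (B x)) ` A"
    using small_image[OF assms(1), of "\<lambda>x. vset (B x)"] unfolding small_def by blast
  obtain u where u: "elts u = (\<Union>y\<in>elts a. elts y)" using union by blast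
  have "elts u = (\<Union>x\<in>A. elts (vset (B x)))" unfolding u a image_image ..
  also have "\<dots> = (\<Union>x\<in>A. B x)" by (intro SUP_cong refl elts_vset assms(2))
  finally show ?thesis by (rule smallI)
qed

lemma small_pair [simp]: "small {x, y}"
  unfolding small_def by (rule pairing)

lemma small_singleton [simp]: "small {x}"
  using small_pair[of x x] unfolding insert_absorb2 .

lemma small_insert: assumes "small A" shows "small (insert x A)"
proof -
  have "small (\<Union>y\<in>{vset {x}, vset A}. elts y)" by (intro small_UN small_pair small_elts)
  moreover have "(\<Union>y\<in>{vset {x}, vset A}. elts y) = elts (vset {x}) \<union> elts (vset A)" by blast
  ultimately have "small (elts (vset {x}) \<union> elts (vset A))" by (rule back_subst)
  then have "small ({x} \<union> A)" unfolding elts_vset[OF assms] elts_vset[OF small_singleton] .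
  then show ?thesis by simp
qed

definition pow :: "'v::zfc_universe \<Rightarrow> 'v"
  where "pow x = vset {y. elts y \<subseteq> elts x}"

lemma elts_pow [simp]: "elts (pow x) = {y. elts y \<subseteq> elts x}"
  unfolding pow_def by (intro elts_vset) (unfold small_def, rule powerset)

lemma vset_inject: "small A \<Longrightarrow> small B \<Longrightarrow> vset A = vset B \<longleftrightarrow> A = B"
  by (metis elts_vset)

lemma kpair_inject [simp]: "kpair a b = kpair c d \<longleftrightarrow> a = c \<and> b = d"
  by (auto simp: kpair_def vset_inject doubleton_eq_iff)

definition product :: "'v::zfc_universe \<Rightarrow> 'v \<Rightarrow> 'v"
  where "product x y = vset (\<Union>u\<in>elts x. kpair u ` elts y)"

lemma elts_product [simp]: "elts (product x y) = (\<Union>u\<in>elts x. kpair u ` elts y)"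
  unfolding product_def by (intro elts_vset small_UN small_image small_elts)

section \<open>Foundation and the linear order of ordinals\<close>

lemma elts_irrefl: "x \<notin> elts x"
  using foundation[of "vset {x}"] by auto

lemma small_minimal:
  assumes "small A" "A \<noteq> {}" shows "\<exists>y\<in>A. elts y \<inter> A = {}"
  using foundation[of "vset A"] assms by auto

lemma ordinal_trans:
  "ordinal z \<Longrightarrow> y \<in> elts z \<Longrightarrow> w \<in> elts x \<Longrightarrow> x \<in> elts y \<Longrightarrow> w \<in> elts y"
  unfolding ordinal_def transitive_def by blast

lemma ordinal_elts_elts: "ordinal z \<Longrightarrow> y \<in> elts z \<Longrightarrow> x \<in> elts y \<Longrightarrow> x \<in> elts z"
  by (auto simp: ordinal_def transitive_def)

text \<open>If this failed, take a membership-minimal \<open>x\<close> incomparable with something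
  and then a membership-minimal \<open>y\<close> incomparable with \<open>x\<close>. Minimality puts
  every element of either one into the other, so extensionality gives \<open>x = y\<close>.\<close>

lemma ordinal_linear:
  assumes z: "ordinal z" and "x \<in> elts z" "y \<in> elts z"
  shows "x \<in> elts y \<or> x = y \<or> y \<in> elts x"
proof (rule ccontr)
  define inc where "inc x y \<longleftrightarrow> \<not> (x \<in> elts y \<or> x = y \<or> y \<in> elts x)" for x y :: 'a
  assume "\<not> ?thesis"
  then have "{x \<in> elts z. \<exists>y\<in>elts z. inc x y} \<noteq> {}" using assms by (auto simp: inc_def)
  then obtain x where x: "x \<in> elts z" "\<exists>y\<in>elts z. inc x y"
      and minx: "elts x \<inter> {x \<in> elts z. \<exists>y\<in>elts z. inc x y} = {}"
    using small_minimal[OF small_subset[OF small_elts[of z]], of "{x \<in> elts z. \<exists>y\<in>elts z. inc x y}"]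
    by auto
  then have "{y \<in> elts z. inc x y} \<noteq> {}" by auto
  then obtain y where y: "y \<in> elts z" "inc x y" and miny: "elts y \<inter> {y \<in> elts z. inc x y} = {}"
    using small_minimal[OF small_subset[OF small_elts[of z]], of "{y \<in> elts z. inc x y}"] by auto
  have "w \<in> elts y" if w: "w \<in> elts x" for w
  proof -
    have "\<not> inc w y" using w minx y(1) ordinal_elts_elts[OF z x(1) w] by blast
    moreover have "y \<notin> elts w" using y(2) ordinal_trans[OF z x(1) _ w] unfolding inc_def by blast
    moreover have "w \<noteq> y" using w y(2) unfolding inc_def by blast
    ultimately show ?thesis unfolding inc_def by blast
  qed
  moreover have "w \<in> elts x" if w: "w \<in> elts y" for w
  proof -
    have "\<not> inc x w" using w miny ordinal_elts_elts[OF z y(1) w] by blast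
    moreover have "x \<notin> elts w" using y(2) ordinal_trans[OF z y(1) _ w] unfolding inc_def by blast
    moreover have "w \<noteq> x" using w y(2) unfolding inc_def by blast
    ultimately show ?thesis unfolding inc_def by blast
  qed
  ultimately have "x = y" by (intro extensionality) blast
  then show False using y(2) unfolding inc_def by blast
qed

section \<open>Projections between finite sets of ordinals\<close>

lemma position_less:
  assumes z: "ordinal z" "s \<subseteq> elts z" "finite s" and "x \<in> s" "y \<in> s" "x \<in> elts y"
  shows "card (s \<inter> elts x) < card (s \<inter> elts y)"
proof (rule psubset_card_mono)
  show "s \<inter> elts x \<subset> s \<inter> elts y"
    using assms ordinal_trans[OF z(1), of y _ x] elts_irrefl[of x] by blast
qed (use assms in auto)

lemma position_less_iff:
  assumes z: "ordinal z" "s \<subseteq> elts z" "finite s" and "x \<in> s" "y \<in> s"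
  shows "card (s \<inter> elts x) < card (s \<inter> elts y) \<longleftrightarrow> x \<in> elts y"
proof -
  have "x \<in> elts y \<or> x = y \<or> y \<in> elts x" using assms by (intro ordinal_linear[OF z(1)]) auto
  then show ?thesis
    using position_less[OF z, of x y] position_less[OF z, of y x] assms by auto
qed

lemma position_inj:
  assumes z: "ordinal z" "s \<subseteq> elts z" "finite s"
  shows "inj_on (\<lambda>x. card (s \<inter> elts x)) s"
proof (rule inj_onI)
  fix x y assume xy: "x \<in> s" "y \<in> s" "card (s \<inter> elts x) = card (s \<inter> elts y)"
  then have "x \<in> elts y \<or> x = y \<or> y \<in> elts x" using z by (intro ordinal_linear[OF z(1)]) auto
  then show "x = y" using position_less[OF z, of x y] position_less[OF z, of y x] xy by auto
qed

text \<open>Positions are injective by linearity, and below the size of \<open>s\<close> because no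
  element counts towards its own position. Finite cardinality does the rest.\<close>

lemma position_bij:
  assumes z: "ordinal z" "s \<subseteq> elts z" "finite s"
  shows "bij_betw (\<lambda>x. card (s \<inter> elts x)) s {..<card s}"
proof -
  have "card (s \<inter> elts x) < card s" if "x \<in> s" for x
    using that z elts_irrefl[of x] by (intro psubset_card_mono) auto
  then have "(\<lambda>x. card (s \<inter> elts x)) ` s \<subseteq> {..<card s}" by auto
  moreover have "card ((\<lambda>x. card (s \<inter> elts x)) ` s) = card s"
    by (rule card_image[OF position_inj[OF z]])
  ultimately show ?thesis
    using position_inj[OF z] by (simp add: bij_betw_def card_subset_eq)
qed

definition order_iso :: "('v::zfc_universe \<Rightarrow> 'v) \<Rightarrow> 'v set \<Rightarrow> 'v set \<Rightarrow> bool"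
  where "order_iso g b s \<longleftrightarrow> bij_betw g b s \<and> (\<forall>x\<in>b. \<forall>y\<in>b. g x \<in> elts (g y) \<longleftrightarrow> x \<in> elts y)"

text \<open>Each element of \<open>b\<close> is sent to the element of \<open>s\<close> that has the
  same position.\<close>

lemma order_iso_exists:
  assumes l: "ordinal l" "b \<subseteq> elts l" "finite b" and z: "ordinal z" "s \<subseteq> elts z" "finite s"
    and card: "card s = card b"
  shows "\<exists>g. order_iso g b s"
proof -
  define pb ps where "pb x = card (b \<inter> elts x)" and "ps x = card (s \<inter> elts x)" for x
  have pb: "bij_betw pb b {..<card b}" and ps: "bij_betw ps s {..<card b}"
    using position_bij[OF l] position_bij[OF z] by (simp_all add: pb_def[abs_def] ps_def[abs_def] card)
  define g where "g = the_inv_into s ps \<circ> pb"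
  have g: "bij_betw g b s" unfolding g_def
    using bij_betw_trans[OF pb bij_betw_the_inv_into[OF ps]] .
  have psg: "ps (g x) = pb x" if "x \<in> b" for x
    using bij_betw_apply[OF pb that] f_the_inv_into_f_bij_betw[OF ps, of "pb x"]
    by (simp add: g_def)
  have "g x \<in> elts (g y) \<longleftrightarrow> x \<in> elts y" if "x \<in> b" "y \<in> b" for x y
  proof -
    have "g x \<in> s" "g y \<in> s" using g that by (auto simp: bij_betw_def)
    then show ?thesis
      using position_less_iff[OF l that] position_less_iff[OF z, of "g x" "g y"]
        psg[OF that(1)] psg[OF that(2)] by (simp add: pb_def ps_def)
  qed
  then have "order_iso g b s" unfolding order_iso_def by (intro conjI g ballI)
  then show ?thesis by (rule exI[of _ g])
qed

lemma order_iso_subset: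
  assumes "order_iso g c s" "b \<subseteq> c"
  shows "order_iso g b (g ` b)"
proof -
  have "inj_on g c" using assms(1) by (simp add: order_iso_def bij_betw_def)
  then have "bij_betw g b (g ` b)" using inj_on_subset[OF _ assms(2)] by (simp add: bij_betw_def)
  then show ?thesis using assms unfolding order_iso_def by (meson subsetD)
qed

text \<open>Increasing bijections preserve positions, and positions determine elements. Identity,
  composition and size of projections thereby become facts about images under one bijection.\<close>

lemma proj_order_iso:
  assumes l: "ordinal l" "b \<subseteq> elts l" "finite b" and g: "order_iso g b s" and a: "a \<subseteq> b"
  shows "proj b a s = g ` a"
proof -
  have inj: "inj_on g b" and s: "s = g ` b" using g by (auto simp: order_iso_def bij_betw_def)
  have pos: "card (s \<inter> elts (g x)) = card (b \<inter> elts x)" if "x \<in> b" for x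
  proof -
    have "s \<inter> elts (g x) = g ` (b \<inter> elts x)"
      using g that by (auto simp: s order_iso_def)
    then show ?thesis using card_image[OF inj_on_subset[OF inj, of "b \<inter> elts x"]] by simp
  qed
  have eq: "x = y" if "x \<in> b" "y \<in> b" "card (b \<inter> elts x) = card (b \<inter> elts y)" for x y
    using inj_onD[OF position_inj[OF l], of x y] that by blast
  show ?thesis
  proof (intro equalityI subsetI)
    fix t assume "t \<in> proj b a s"
    then obtain x y where "x \<in> a" "y \<in> b" "t = g y" "card (b \<inter> elts x) = card (s \<inter> elts (g y))"
      using s unfolding proj_def by blast
    then show "t \<in> g ` a" using eq[of x y] pos[of y] a by auto
  next
    fix t assume "t \<in> g ` a"
    then obtain x where "x \<in> a" "t = g x" by auto
    moreover from this have "card (b \<inter> elts x) = card (s \<inter> elts (g x))" using pos a by auto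
    ultimately show "t \<in> proj b a s" using a s unfolding proj_def by blast
  qed
qed

lemma proj_self:
  assumes "ordinal l" "b \<subseteq> elts l" "finite b" "ordinal z" "s \<in> [elts z]\<^bsup>card b\<^esup>"
  shows "proj b b s = s"
proof -
  have "s \<subseteq> elts z" "finite s" "card s = card b" using assms(5) by (auto simp: nsets_def)
  then obtain g where g: "order_iso g b s"
    using order_iso_exists[OF assms(1-4)] by blast
  then show ?thesis
    using proj_order_iso[OF assms(1-3) g] by (auto simp: order_iso_def bij_betw_def)
qed

text \<open>The increasing bijection from \<open>c\<close> onto \<open>s\<close> restricts to the
  one from \<open>b\<close> onto \<open>proj c b s\<close>, so both sides are the image of
  \<open>a\<close> under it.\<close>

lemma proj_proj:
  assumes l: "ordinal l" "c \<subseteq> elts l" "finite c" and z: "ordinal z" "s \<in> [elts z]\<^bsup>card c\<^esup>"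
    and ab: "a \<subseteq> b" "b \<subseteq> c"
  shows "proj b a (proj c b s) = proj c a s"
proof -
  have s: "s \<subseteq> elts z" "finite s" "card s = card c" using z(2) by (auto simp: nsets_def)
  obtain g where g: "order_iso g c s" using order_iso_exists[OF l z(1) s] by blast
  have "proj c b s = g ` b" "proj c a s = g ` a" using proj_order_iso[OF l g] ab by auto
  moreover have "proj b a (g ` b) = g ` a"
    using l ab by (intro proj_order_iso[OF l(1)] order_iso_subset[OF g])
      (auto intro: finite_subset)
  ultimately show ?thesis by simp
qed

lemma proj_in_nsets:
  assumes l: "ordinal l" "b \<subseteq> elts l" "finite b" and z: "ordinal z" "s \<in> [elts z]\<^bsup>card b\<^esup>"
    and a: "a \<subseteq> b"
  shows "proj b a s \<in> [elts z]\<^bsup>card a\<^esup>"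
proof -
  have s: "s \<subseteq> elts z" "finite s" "card s = card b" using z(2) by (auto simp: nsets_def)
  obtain g where g: "order_iso g b s" using order_iso_exists[OF l z(1) s] by blast
  have "inj_on g b" using g by (simp add: order_iso_def bij_betw_def)
  then have "inj_on g a" by (rule inj_on_subset[OF _ a])
  then have "card (g ` a) = card a" by (rule card_image)
  moreover have "g ` a \<subseteq> elts z" using s(1) g a unfolding order_iso_def bij_betw_def by blast
  moreover have "finite (g ` a)" using finite_subset[OF a l(3)] by simp
  ultimately show ?thesis by (simp add: proj_order_iso[OF l g a] nsets_def)
qed

section \<open>Extender ultrapowers\<close>

abbreviation supports :: "'v::zfc_universe ext_system \<Rightarrow> 'v set set"
  where "supports E \<equiv> Fpow (elts (ext_len E))"

abbreviation points :: "'v::zfc_universe ext_system \<Rightarrow> 'v set \<Rightarrow> 'v set set"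
  where "points E a \<equiv> [elts (ext_space E)]\<^bsup>card a\<^esup>"

text \<open>Membership in a measure is phrased as a quantifier over points, so that the ultrafilter
  axioms and coherence become rules of inference.\<close>

definition ae :: "'v::zfc_universe ext_system \<Rightarrow> 'v set \<Rightarrow> ('v set \<Rightarrow> bool) \<Rightarrow> bool"
  where "ae E a Q \<longleftrightarrow> {s \<in> points E a. Q s} \<in> ext_meas E a"

abbreviation val :: "'v::zfc_universe ext_system \<Rightarrow> 'v set \<Rightarrow> ('v set \<Rightarrow> 'v) \<Rightarrow> 'v"
  where "val E a f \<equiv> ult_collapse E (a, f)"

lemma supports_Un: "a \<in> supports E \<Longrightarrow> b \<in> supports E \<Longrightarrow> a \<union> b \<in> supports E"
  by (auto simp: Fpow_def)

lemma supports_empty: "{} \<in> supports E"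
  by (auto simp: Fpow_def)

lemma supports_subset: "b \<in> supports E \<Longrightarrow> a \<subseteq> b \<Longrightarrow> a \<in> supports E"
  by (auto simp: Fpow_def intro: finite_subset)

lemma ultrafilter_onD:
  assumes "ultrafilter_on I U"
  shows "I \<in> U" "{} \<notin> U"
    "X \<in> U \<Longrightarrow> X \<subseteq> Y \<Longrightarrow> Y \<subseteq> I \<Longrightarrow> Y \<in> U"
    "X \<in> U \<Longrightarrow> Y \<in> U \<Longrightarrow> X \<inter> Y \<in> U"
    "X \<subseteq> I \<Longrightarrow> X \<in> U \<or> I - X \<in> U"
  using assms unfolding ultrafilter_on_def by simp_all

context
  fixes E :: "'v::zfc_universe ext_system"
  assumes ext: "extender E"
begin

lemma ordinal_len: "ordinal (ext_len E)"
  by (rule ext[unfolded extender_def, THEN conjunct1])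

lemma ordinal_space: "ordinal (ext_space E)"
  by (rule ext[unfolded extender_def, THEN conjunct2, THEN conjunct1])

lemma meas_ultrafilter: "a \<in> supports E \<Longrightarrow> ultrafilter_on (points E a) (ext_meas E a)"
  by (rule bspec[OF ext[unfolded extender_def, THEN conjunct2, THEN conjunct2, THEN conjunct1]])

lemma coherence:
  assumes "a \<in> supports E" "b \<in> supports E" "a \<subseteq> b" "X \<subseteq> points E a"
  shows "X \<in> ext_meas E a \<longleftrightarrow> {s \<in> points E b. proj b a s \<in> X} \<in> ext_meas E b"
  by (rule ext[unfolded extender_def, THEN conjunct2, THEN conjunct2, THEN conjunct2,
        THEN conjunct1, rule_format, OF assms])

lemma wf_ult_mem: "wfp (ult_mem E)"
  by (rule ext[unfolded extender_def, THEN conjunct2, THEN conjunct2, THEN conjunct2,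
        THEN conjunct2, THEN conjunct2])

lemma points_proj:
  assumes "b \<in> supports E" "s \<in> points E b" "a \<subseteq> b" shows "proj b a s \<in> points E a"
  using proj_in_nsets[OF ordinal_len _ _ ordinal_space assms(2,3)] assms(1) by (simp add: Fpow_def)

lemma proj_same:
  assumes "b \<in> supports E" "s \<in> points E b" shows "proj b b s = s"
  using proj_self[OF ordinal_len _ _ ordinal_space assms(2)] assms(1) by (simp add: Fpow_def)

lemma proj_comp:
  assumes "c \<in> supports E" "s \<in> points E c" "a \<subseteq> b" "b \<subseteq> c"
  shows "proj b a (proj c b s) = proj c a s"
  using proj_proj[OF ordinal_len _ _ ordinal_space assms(2-4)] assms(1) by (simp add: Fpow_def)

section \<open>The almost-everywhere quantifier and changes of support\<close>

lemma ae_mono: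
  assumes "a \<in> supports E" "ae E a P" "\<And>s. s \<in> points E a \<Longrightarrow> P s \<Longrightarrow> Q s"
  shows "ae E a Q"
  unfolding ae_def
proof (rule ultrafilter_onD(3)[OF meas_ultrafilter[OF assms(1)] assms(2)[unfolded ae_def]])
  show "{s \<in> points E a. P s} \<subseteq> {s \<in> points E a. Q s}" using assms(3) by blast
qed blast

lemma ae_cong:
  assumes "a \<in> supports E" "\<And>s. s \<in> points E a \<Longrightarrow> P s \<longleftrightarrow> Q s"
  shows "ae E a P \<longleftrightarrow> ae E a Q"
proof -
  have "{s \<in> points E a. P s} = {s \<in> points E a. Q s}" using assms(2) by blast
  then show ?thesis unfolding ae_def by (rule arg_cong)
qed

lemma ae_all:
  assumes "a \<in> supports E" "\<And>s. s \<in> points E a \<Longrightarrow> Q s"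
  shows "ae E a Q"
proof -
  have "points E a = {s \<in> points E a. Q s}" using assms(2) by blast
  then show ?thesis
    using ultrafilter_onD(1)[OF meas_ultrafilter[OF assms(1)]] unfolding ae_def by (rule subst)
qed

lemma ae_conj:
  assumes "a \<in> supports E" "ae E a P" "ae E a Q"
  shows "ae E a (\<lambda>s. P s \<and> Q s)"
proof -
  have "{s \<in> points E a. P s} \<inter> {s \<in> points E a. Q s} \<in> ext_meas E a"
    by (rule ultrafilter_onD(4)[OF meas_ultrafilter[OF assms(1)] assms(2,3)[unfolded ae_def]])
  moreover have "{s \<in> points E a. P s} \<inter> {s \<in> points E a. Q s} = {s \<in> points E a. P s \<and> Q s}"
    by blast
  ultimately show ?thesis unfolding ae_def by (rule back_subst)
qed

lemma ae_ex:
  assumes "a \<in> supports E" "ae E a Q"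
  shows "\<exists>s\<in>points E a. Q s"
proof (rule ccontr)
  assume "\<not> ?thesis"
  then have "{s \<in> points E a. Q s} = {}" by blast
  then have "{} \<in> ext_meas E a" using assms(2) unfolding ae_def by (rule subst)
  then show False using ultrafilter_onD(2)[OF meas_ultrafilter[OF assms(1)]] by contradiction
qed

lemma ae_not:
  assumes "a \<in> supports E"
  shows "ae E a (\<lambda>s. \<not> Q s) \<longleftrightarrow> \<not> ae E a Q"
proof
  assume "ae E a (\<lambda>s. \<not> Q s)"
  then show "\<not> ae E a Q" using ae_ex[OF assms ae_conj[OF assms, of "\<lambda>s. \<not> Q s" Q]] by blast
next
  assume "\<not> ae E a Q"
  moreover have "{s \<in> points E a. Q s} \<in> ext_meas E a
      \<or> points E a - {s \<in> points E a. Q s} \<in> ext_meas E a"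
    by (rule ultrafilter_onD(5)[OF meas_ultrafilter[OF assms]]) blast
  moreover have "points E a - {s \<in> points E a. Q s} = {s \<in> points E a. \<not> Q s}" by blast
  ultimately show "ae E a (\<lambda>s. \<not> Q s)" unfolding ae_def by simp
qed

text \<open>Coherence, stated for properties. It lets statements about different supports be
  compared on a common larger one.\<close>

lemma ae_proj:
  assumes b: "b \<in> supports E" and ab: "a \<subseteq> b"
  shows "ae E b (\<lambda>s. Q (proj b a s)) \<longleftrightarrow> ae E a Q"
proof -
  have a: "a \<in> supports E" using supports_subset[OF b ab] .
  have "{s \<in> points E b. proj b a s \<in> {s \<in> points E a. Q s}} = {s \<in> points E b. Q (proj b a s)}"
    using points_proj[OF b _ ab] by blast
  then show ?thesis unfolding ae_def using coherence[OF a b ab, of "{s \<in> points E a. Q s}"] by simp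
qed

text \<open>Any common support computes the relation: coherence moves the definition from
  \<open>a \<union> b\<close> to \<open>c\<close>, and projections compose.\<close>

lemma ult_mem_iff:
  assumes c: "c \<in> supports E" and ab: "a \<subseteq> c" "b \<subseteq> c"
  shows "ult_mem E (a, f) (b, g) \<longleftrightarrow> ae E c (\<lambda>s. f (proj c a s) \<in> elts (g (proj c b s)))"
proof -
  have abc: "a \<union> b \<subseteq> c" using ab by blast
  have "a \<in> supports E" "b \<in> supports E" using supports_subset[OF c] ab by blast+
  then have "ult_mem E (a, f) (b, g) \<longleftrightarrow>
      ae E (a \<union> b) (\<lambda>s. f (proj (a \<union> b) a s) \<in> elts (g (proj (a \<union> b) b s)))"
    unfolding ult_mem_def ult_reps_def ae_def by simp
  also have "\<dots> \<longleftrightarrow> ae E c (\<lambda>s. f (proj (a \<union> b) a (proj c (a \<union> b) s))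
      \<in> elts (g (proj (a \<union> b) b (proj c (a \<union> b) s))))"
    by (rule ae_proj[OF c abc, symmetric])
  also have "\<dots> \<longleftrightarrow> ae E c (\<lambda>s. f (proj c a s) \<in> elts (g (proj c b s)))"
  proof (rule ae_cong[OF c])
    fix s assume s: "s \<in> points E c"
    have "proj (a \<union> b) a (proj c (a \<union> b) s) = proj c a s"
      "proj (a \<union> b) b (proj c (a \<union> b) s) = proj c b s"
      using proj_comp[OF c s _ abc] by simp_all
    then show "f (proj (a \<union> b) a (proj c (a \<union> b) s)) \<in> elts (g (proj (a \<union> b) b (proj c (a \<union> b) s)))
        \<longleftrightarrow> f (proj c a s) \<in> elts (g (proj c b s))" by simp
  qed
  finally show ?thesis .
qed

lemma ult_mem_supports: "ult_mem E (a, f) (b, g) \<Longrightarrow> a \<in> supports E \<and> b \<in> supports E"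
  unfolding ult_mem_def ult_reps_def by simp

lemma no_ult_chain: "\<not> (\<forall>k::nat. ult_mem E (p (Suc k)) (p k))"
  using wf_ult_mem[unfolded wfp_def wf_iff_no_infinite_down_chain] by simp

section \<open>The Mostowski collapse of the ultrapower\<close>

lemma ult_collapse_rec: "ult_collapse E q = vset (ult_collapse E ` {p. ult_mem E p q})"
proof -
  have "wf {(p, q). ult_mem E p q}" using wf_ult_mem unfolding wfp_def .
  from wfrec[OF this, of "\<lambda>c q. vset (c ` {p. ult_mem E p q})" q]
  have "ult_collapse E q =
      vset (cut (ult_collapse E) {(p, q). ult_mem E p q} q ` {p. ult_mem E p q})"
    unfolding ult_collapse_def .
  also have "cut (ult_collapse E) {(p, q). ult_mem E p q} q ` {p. ult_mem E p q} =
      ult_collapse E ` {p. ult_mem E p q}"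
    by (intro image_cong refl) (simp add: cut_apply)
  finally show ?thesis .
qed

lemma ult_collapse_cong:
  "(\<And>p. ult_mem E p q \<longleftrightarrow> ult_mem E p q') \<Longrightarrow> ult_collapse E q = ult_collapse E q'"
  using ult_collapse_rec[of q] ult_collapse_rec[of q'] by simp

lemma ult_mem_same:
  assumes "a \<in> supports E"
  shows "ult_mem E (a, f) (a, g) \<longleftrightarrow> ae E a (\<lambda>s. f s \<in> elts (g s))"
  using ult_mem_iff[OF assms order_refl order_refl, of f g]
    ae_proj[OF assms order_refl, of "\<lambda>s. f s \<in> elts (g s)"] by simp

lemma ult_mem_proj_left:
  assumes b: "b \<in> supports E" and ab: "a \<subseteq> b"
  shows "ult_mem E (b, \<lambda>s. f (proj b a s)) q \<longleftrightarrow> ult_mem E (a, f) q"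
proof (cases q)
  case (Pair c g)
  show ?thesis
  proof (cases "c \<in> supports E")
    case True
    have d: "b \<union> c \<in> supports E" by (rule supports_Un[OF b True])
    have sub: "b \<subseteq> b \<union> c" "a \<subseteq> b \<union> c" "c \<subseteq> b \<union> c" using ab by auto
    show ?thesis
      unfolding Pair ult_mem_iff[OF d sub(1,3)] ult_mem_iff[OF d sub(2,3)]
      by (rule ae_cong[OF d]) (simp add: proj_comp[OF d _ ab sub(1)])
  next
    case False
    then show ?thesis unfolding Pair using ult_mem_supports by blast
  qed
qed

lemma ult_mem_proj_right:
  assumes b: "b \<in> supports E" and ab: "a \<subseteq> b"
  shows "ult_mem E p (b, \<lambda>s. f (proj b a s)) \<longleftrightarrow> ult_mem E p (a, f)"
proof (cases p)
  case (Pair c g)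
  show ?thesis
  proof (cases "c \<in> supports E")
    case True
    have d: "b \<union> c \<in> supports E" by (rule supports_Un[OF b True])
    have sub: "b \<subseteq> b \<union> c" "a \<subseteq> b \<union> c" "c \<subseteq> b \<union> c" using ab by auto
    show ?thesis
      unfolding Pair ult_mem_iff[OF d sub(3,1)] ult_mem_iff[OF d sub(3,2)]
      by (rule ae_cong[OF d]) (simp add: proj_comp[OF d _ ab sub(1)])
  next
    case False
    then show ?thesis unfolding Pair using ult_mem_supports by blast
  qed
qed

text \<open>Passing to a larger support leaves the \<open>ult_mem\<close>-predecessors unchanged,
  and these determine the collapse.\<close>

lemma val_proj:
  assumes "b \<in> supports E" "a \<subseteq> b"
  shows "val E b (\<lambda>s. f (proj b a s)) = val E a f"
  by (rule ult_collapse_cong) (rule ult_mem_proj_right[OF assms])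

lemma val_ae_cong:
  assumes a: "a \<in> supports E" and eq: "ae E a (\<lambda>s. f s = g s)"
  shows "val E a f = val E a g"
proof (rule ult_collapse_cong)
  fix p :: "'v set \<times> ('v set \<Rightarrow> 'v)"
  obtain c h where p: "p = (c, h)" by (cases p)
  show "ult_mem E p (a, f) \<longleftrightarrow> ult_mem E p (a, g)"
  proof (cases "c \<in> supports E")
    case True
    have d: "a \<union> c \<in> supports E" by (rule supports_Un[OF a True])
    have sub: "a \<subseteq> a \<union> c" "c \<subseteq> a \<union> c" by auto
    have eq': "ae E (a \<union> c) (\<lambda>s. f (proj (a \<union> c) a s) = g (proj (a \<union> c) a s))"
      using ae_proj[OF d sub(1), of "\<lambda>s. f s = g s"] eq by simp
    show ?thesis
      unfolding p ult_mem_iff[OF d sub(2,1)]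
    proof
      assume "ae E (a \<union> c) (\<lambda>s. h (proj (a \<union> c) c s) \<in> elts (f (proj (a \<union> c) a s)))"
      from ae_conj[OF d eq' this]
      show "ae E (a \<union> c) (\<lambda>s. h (proj (a \<union> c) c s) \<in> elts (g (proj (a \<union> c) a s)))"
        by (rule ae_mono[OF d]) metis
    next
      assume "ae E (a \<union> c) (\<lambda>s. h (proj (a \<union> c) c s) \<in> elts (g (proj (a \<union> c) a s)))"
      from ae_conj[OF d eq' this]
      show "ae E (a \<union> c) (\<lambda>s. h (proj (a \<union> c) c s) \<in> elts (f (proj (a \<union> c) a s)))"
        by (rule ae_mono[OF d]) metis
    qed
  next
    case False
    then show ?thesis unfolding p using ult_mem_supports by blast
  qed
qed

lemma points_small: "s \<in> points E a \<Longrightarrow> small s"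
  by (rule small_subset[OF small_elts[of "ext_space E"]]) (simp add: nsets_def)

lemma points_vset: "s \<in> points E a \<Longrightarrow> vset s \<in> elts (pow (ext_space E))"
  using points_small[of s a] by (simp add: nsets_def)

text \<open>There is a proper class of representatives below a given one, but up to equivalence each is
  decoded from its graph, and these graphs range over a set.\<close>

lemma small_predecessors: "small (ult_collapse E ` {p. ult_mem E p q})"
proof (cases q)
  case (Pair b g)
  \<comment> \<open>\<open>D\<close> contains codes of all points and \<open>Y d\<close> bounds the
    values of functions below \<open>g\<close>; thus \<open>G d\<close> contains all graphs needed
    on support \<open>d\<close>, and \<open>dec\<close> recovers a function from its graph.\<close>
  define D where "D = pow (ext_space E)"
  define Y where "Y d = vset (\<Union>u\<in>elts D. elts (g (proj d b (elts u))))" for d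
  define G where "G d = pow (product D (Y d))" for d
  define dec where "dec z s = (THE y. kpair (vset s) y \<in> elts z)" for z :: 'v and s :: "'v set"
  have Y: "elts (Y d) = (\<Union>u\<in>elts D. elts (g (proj d b (elts u))))" for d
    unfolding Y_def by (intro elts_vset small_UN small_elts)
  have "small (\<Union>u\<in>elts (pow (ext_len E)). (\<lambda>z. val E (elts u) (dec z)) ` elts (G (elts u)))"
    by (intro small_UN small_image small_elts)
  moreover have "ult_collapse E ` {p. ult_mem E p q} \<subseteq>
      (\<Union>u\<in>elts (pow (ext_len E)). (\<lambda>z. val E (elts u) (dec z)) ` elts (G (elts u)))"
  proof (intro image_subsetI)
    fix p assume "p \<in> {p. ult_mem E p q}"
    moreover obtain a f where p: "p = (a, f)" by (cases p)
    ultimately have mem: "ult_mem E (a, f) (b, g)" by (simp add: Pair)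
    define d where "d = a \<union> b"
    have d: "d \<in> supports E" using ult_mem_supports[OF mem] unfolding d_def by (intro supports_Un) auto
    have sub: "a \<subseteq> d" "b \<subseteq> d" by (auto simp: d_def)
    have fg: "ae E d (\<lambda>s. f (proj d a s) \<in> elts (g (proj d b s)))"
      using mem unfolding ult_mem_iff[OF d sub] .
    \<comment> \<open>Only points where \<open>f\<close> falls into \<open>g\<close> are recorded.
      This keeps the graph inside \<open>product D (Y d)\<close>, and almost every point is of this
      kind, so the decoded function agrees with \<open>f\<close> almost everywhere.\<close>
    define A where "A = {kpair (vset s) (f (proj d a s)) |s.
      s \<in> points E d \<and> f (proj d a s) \<in> elts (g (proj d b s))}"
    have A: "A \<subseteq> elts (product D (Y d))"
    proof
      fix x assume "x \<in> A"
      then obtain s where s: "x = kpair (vset s) (f (proj d a s))" "s \<in> points E d"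
        "f (proj d a s) \<in> elts (g (proj d b s))" unfolding A_def by blast
      have "vset s \<in> elts D" unfolding D_def by (rule points_vset[OF s(2)])
      moreover have "elts (vset s) = s" by (rule elts_vset[OF points_small[OF s(2)]])
      ultimately have "f (proj d a s) \<in> elts (Y d)" unfolding Y using s(3) by (intro UN_I[of "vset s"]) simp_all
      with \<open>vset s \<in> elts D\<close> show "x \<in> elts (product D (Y d))"
        unfolding s(1) elts_product by (intro UN_I[of "vset s"] imageI)
    qed
    have sA: "small A" by (rule small_subset[OF small_elts A])
    have zG: "vset A \<in> elts (G d)" unfolding G_def using A by (simp add: elts_vset[OF sA] del: elts_product)
    have "ae E d (\<lambda>s. f (proj d a s) = dec (vset A) s)"
    proof (rule ae_mono[OF d fg])
      fix s assume s: "s \<in> points E d" "f (proj d a s) \<in> elts (g (proj d b s))"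
      have "kpair (vset s) y \<in> A \<longleftrightarrow> y = f (proj d a s)" for y
      proof
        assume "kpair (vset s) y \<in> A"
        then obtain t where t: "t \<in> points E d" "vset s = vset t" "y = f (proj d a t)"
          unfolding A_def by auto
        then have "s = t" using vset_inject[OF points_small[OF s(1)] points_small[OF t(1)]] by simp
        with t show "y = f (proj d a s)" by simp
      next
        assume "y = f (proj d a s)"
        with s show "kpair (vset s) y \<in> A" unfolding A_def by blast
      qed
      then show "f (proj d a s) = dec (vset A) s" unfolding dec_def by (simp add: elts_vset[OF sA])
    qed
    from val_ae_cong[OF d this] have "ult_collapse E p = val E d (dec (vset A))"
      unfolding p val_proj[OF d sub(1)] .
    moreover have "d \<subseteq> elts (ext_len E)" using d by (simp add: Fpow_def)
    moreover have "small d" by (rule small_subset[OF small_elts \<open>d \<subseteq> elts (ext_len E)\<close>])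
    ultimately show "ult_collapse E p \<in>
        (\<Union>u\<in>elts (pow (ext_len E)). (\<lambda>z. val E (elts u) (dec z)) ` elts (G (elts u)))"
      using zG by (intro UN_I[of "vset d"]) simp_all
  qed
  ultimately show ?thesis by (rule small_subset)
qed

section \<open>Los's theorem for equality and membership\<close>

lemma elts_ult_collapse: "elts (ult_collapse E q) = ult_collapse E ` {p. ult_mem E p q}"
  using ult_collapse_rec[of q] elts_vset[OF small_predecessors[of q]] by simp

text \<open>Injectivity of the collapse. If \<open>f\<close> and \<open>g\<close> differ almost
  everywhere, some \<open>h\<close> picks elements of one outside the other. As the two values
  agree, \<open>h\<close> has the same value as a predecessor \<open>k\<close> of the other
  function; by induction \<open>h\<close> and \<open>k\<close> agree almost everywhere, which is
  impossible.\<close>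

lemma val_eqD_aux:
  "val E a f = val E a g \<Longrightarrow> a \<in> supports E \<Longrightarrow> ae E a (\<lambda>s. f s = g s)"
proof (induction "(a, f)" arbitrary: a f g rule: wfp_induct_rule[OF wf_ult_mem])
  case (1 a f g)
  note a = \<open>a \<in> supports E\<close>
  have lift: "\<exists>d k. d \<in> supports E \<and> a \<subseteq> d \<and> ult_mem E (d, k) (a, g') \<and>
      val E d (\<lambda>s. h (proj d a s)) = val E d k"
    if h: "ae E a (\<lambda>s. h s \<in> elts (f' s))" and fg': "val E a f' = val E a g'" for f' g' h
  proof -
    have "val E a h \<in> elts (val E a f')"
      unfolding elts_ult_collapse using h ult_mem_same[OF a] by blast
    then obtain c k where k: "ult_mem E (c, k) (a, g')" "val E a h = val E c k"
      unfolding fg' elts_ult_collapse by auto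
    define d where "d = a \<union> c"
    have d: "d \<in> supports E" unfolding d_def using ult_mem_supports[OF k(1)] by (intro supports_Un) auto
    have sub: "a \<subseteq> d" "c \<subseteq> d" by (auto simp: d_def)
    have "ult_mem E (d, \<lambda>s. k (proj d c s)) (a, g')" using ult_mem_proj_left[OF d sub(2)] k(1) by simp
    moreover have "val E d (\<lambda>s. h (proj d a s)) = val E d (\<lambda>s. k (proj d c s))"
      using val_proj[OF d sub(1)] val_proj[OF d sub(2)] k(2) by simp
    ultimately show ?thesis using d sub(1) by blast
  qed
  have fin: False
    if h: "ae E a (\<lambda>s. h s \<notin> elts (g' s))" and d: "d \<in> supports E" "a \<subseteq> d"
      and k: "ult_mem E (d, k) (a, g')" and hk: "ae E d (\<lambda>s. h (proj d a s) = k s)" for g' h d k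
  proof -
    have "ae E d (\<lambda>s. k s \<in> elts (g' (proj d a s)))"
      using k ult_mem_same[OF d(1), of k "\<lambda>s. g' (proj d a s)"] ult_mem_proj_right[OF d, of _ g'] by simp
    from ae_conj[OF d(1) hk this] have "ae E d (\<lambda>s. h (proj d a s) \<in> elts (g' (proj d a s)))"
      by (rule ae_mono[OF d(1)]) simp
    then have "ae E a (\<lambda>s. h s \<in> elts (g' s))" using ae_proj[OF d, of "\<lambda>s. h s \<in> elts (g' s)"] by simp
    with h show False using ae_not[OF a] by blast
  qed
  show ?case
  proof (rule ccontr)
    assume "\<not> ?case"
    then have neq: "ae E a (\<lambda>s. f s \<noteq> g s)" using ae_not[OF a] by blast
    show False
    proof (cases "ae E a (\<lambda>s. \<exists>z. z \<in> elts (f s) \<and> z \<notin> elts (g s))")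
      case True
      define h where "h s = (SOME z. z \<in> elts (f s) \<and> z \<notin> elts (g s))" for s
      have h: "ae E a (\<lambda>s. h s \<in> elts (f s) \<and> h s \<notin> elts (g s))"
        using True unfolding h_def by (rule ae_mono[OF a]) (rule someI_ex)
      then have h1: "ae E a (\<lambda>s. h s \<in> elts (f s))" and h2: "ae E a (\<lambda>s. h s \<notin> elts (g s))"
        by (auto elim: ae_mono[OF a])
      obtain d k where d: "d \<in> supports E" "a \<subseteq> d" and k: "ult_mem E (d, k) (a, g)"
        "val E d (\<lambda>s. h (proj d a s)) = val E d k" using lift[OF h1 1(2)] by blast
      have "ult_mem E (d, \<lambda>s. h (proj d a s)) (a, f)"
        using ult_mem_proj_left[OF d] ult_mem_same[OF a] h1 by simp
      from 1(1)[OF this k(2) d(1)] show False by (rule fin[OF h2 d k(1)])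
    next
      case False
      then have "ae E a (\<lambda>s. \<not> (\<exists>z. z \<in> elts (f s) \<and> z \<notin> elts (g s)))" using ae_not[OF a] by blast
      from ae_conj[OF a neq this] have ex: "ae E a (\<lambda>s. \<exists>z. z \<in> elts (g s) \<and> z \<notin> elts (f s))"
      proof (rule ae_mono[OF a])
        fix s assume fg: "f s \<noteq> g s \<and> \<not> (\<exists>z. z \<in> elts (f s) \<and> z \<notin> elts (g s))"
        then have "elts (f s) \<noteq> elts (g s)" using extensionality[of "f s" "g s"] by blast
        with fg show "\<exists>z. z \<in> elts (g s) \<and> z \<notin> elts (f s)" by blast
      qed
      define h where "h s = (SOME z. z \<in> elts (g s) \<and> z \<notin> elts (f s))" for s
      have h: "ae E a (\<lambda>s. h s \<in> elts (g s) \<and> h s \<notin> elts (f s))"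
        using ex unfolding h_def by (rule ae_mono[OF a]) (rule someI_ex)
      then have h1: "ae E a (\<lambda>s. h s \<in> elts (g s))" and h2: "ae E a (\<lambda>s. h s \<notin> elts (f s))"
        by (auto elim: ae_mono[OF a])
      obtain d k where d: "d \<in> supports E" "a \<subseteq> d" and k: "ult_mem E (d, k) (a, f)"
        "val E d (\<lambda>s. h (proj d a s)) = val E d k" using lift[OF h1 1(2)[symmetric]] by blast
      \<comment> \<open>Now \<open>h\<close> lies below \<open>g\<close>, so the induction
        hypothesis is applied to \<open>k\<close>, the predecessor of \<open>(a, f)\<close>.\<close>
      from 1(1)[OF k(1) k(2)[symmetric] d(1)] have "ae E d (\<lambda>s. h (proj d a s) = k s)"
        by (rule ae_mono[OF d(1)]) simp
      then show False by (rule fin[OF h2 d k(1)])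
    qed
  qed
qed

lemma val_eq_iff:
  assumes "a \<in> supports E"
  shows "val E a f = val E a g \<longleftrightarrow> ae E a (\<lambda>s. f s = g s)"
  using val_eqD_aux[of a f g] val_ae_cong[of a f g] assms by blast

text \<open>An element of a collapsed value comes from a predecessor \<open>k\<close>, possibly on
  another support. On the union of the supports the equality criterion replaces \<open>k\<close> by
  \<open>f\<close>.\<close>

lemma val_mem_iff:
  assumes a: "a \<in> supports E"
  shows "val E a f \<in> elts (val E a g) \<longleftrightarrow> ae E a (\<lambda>s. f s \<in> elts (g s))"
proof
  assume "ae E a (\<lambda>s. f s \<in> elts (g s))"
  then show "val E a f \<in> elts (val E a g)"
    unfolding elts_ult_collapse using ult_mem_same[OF a] by blast
next
  assume "val E a f \<in> elts (val E a g)"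
  then obtain c k where k: "ult_mem E (c, k) (a, g)" "val E a f = val E c k"
    unfolding elts_ult_collapse by auto
  define d where "d = a \<union> c"
  have d: "d \<in> supports E" unfolding d_def using ult_mem_supports[OF k(1)] by (intro supports_Un) auto
  have sub: "a \<subseteq> d" "c \<subseteq> d" by (auto simp: d_def)
  have "val E d (\<lambda>s. f (proj d a s)) = val E d (\<lambda>s. k (proj d c s))"
    using val_proj[OF d sub(1)] val_proj[OF d sub(2)] k(2) by simp
  then have "ae E d (\<lambda>s. f (proj d a s) = k (proj d c s))" by (rule val_eq_iff[OF d, THEN iffD1])
  moreover have "ae E d (\<lambda>s. k (proj d c s) \<in> elts (g (proj d a s)))"
    using k(1) unfolding ult_mem_iff[OF d sub(2,1)] .
  ultimately have "ae E d (\<lambda>s. f (proj d a s) \<in> elts (g (proj d a s)))"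
    by (rule ae_mono[OF d ae_conj[OF d]]) simp
  then show "ae E a (\<lambda>s. f s \<in> elts (g s))"
    using ae_proj[OF d sub(1), of "\<lambda>s. f s \<in> elts (g s)"] by simp
qed

lemma ult_rep: "x \<in> ult E \<Longrightarrow> \<exists>a f. a \<in> supports E \<and> x = val E a f"
  unfolding ult_def ult_reps_def by auto

lemma val_in_ult: "a \<in> supports E \<Longrightarrow> val E a f \<in> ult E"
  unfolding ult_def ult_reps_def by auto

lemma ult_rep_above:
  assumes "x \<in> ult E" "a \<in> supports E"
  shows "\<exists>b f. b \<in> supports E \<and> a \<subseteq> b \<and> x = val E b f"
proof -
  obtain c f where c: "c \<in> supports E" "x = val E c f" using ult_rep[OF assms(1)] by blast
  have "x = val E (a \<union> c) (\<lambda>s. f (proj (a \<union> c) c s))"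
    using val_proj[OF supports_Un[OF assms(2) c(1)], of c f] c(2) by simp
  then show ?thesis using supports_Un[OF assms(2) c(1)] by blast
qed

lemma ult_trans:
  assumes "x \<in> elts y" "y \<in> ult E" shows "x \<in> ult E"
proof -
  obtain q where "y = ult_collapse E q" using assms(2) unfolding ult_def by blast
  then obtain p where p: "ult_mem E p q" "x = ult_collapse E p"
    using assms(1) elts_ult_collapse[of q] by auto
  then have "p \<in> ult_reps E" unfolding ult_mem_def by simp
  then show ?thesis unfolding p(2) ult_def by (rule imageI)
qed

section \<open>Pairing inside the ultrapower, and the embedding\<close>

lemma ae_disj:
  assumes "a \<in> supports E"
  shows "ae E a (\<lambda>s. P s \<or> Q s) \<longleftrightarrow> ae E a P \<or> ae E a Q"
proof
  assume PQ: "ae E a (\<lambda>s. P s \<or> Q s)"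
  show "ae E a P \<or> ae E a Q"
  proof (cases "ae E a P")
    case False
    then have "ae E a (\<lambda>s. \<not> P s)" using ae_not[OF assms, of P] by simp
    from ae_conj[OF assms PQ this] have "ae E a Q" by (rule ae_mono[OF assms]) blast
    then show ?thesis ..
  qed simp
next
  assume "ae E a P \<or> ae E a Q"
  then show "ae E a (\<lambda>s. P s \<or> Q s)"
  proof
    assume "ae E a P" then show ?thesis by (rule ae_mono[OF assms]) simp
  next
    assume "ae E a Q" then show ?thesis by (rule ae_mono[OF assms]) simp
  qed
qed

text \<open>The ultrapower is transitive, so testing its own elements \<open>x\<close> suffices. For
  these, Los's theorem and the splitting of a disjunction by an ultrafilter leave just the two
  components.\<close>

lemma val_upair:
  assumes a: "a \<in> supports E"
  shows "val E a (\<lambda>s. vset {f s, g s}) = vset {val E a f, val E a g}"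
proof -
  have mem: "x \<in> elts (val E a (\<lambda>s. vset {f s, g s})) \<longleftrightarrow> x = val E a f \<or> x = val E a g"
    if x: "x \<in> ult E" for x
  proof -
    obtain b h where b: "b \<in> supports E" "a \<subseteq> b" "x = val E b h" using ult_rep_above[OF x a] by blast
    have "val E a (\<lambda>s. vset {f s, g s}) = val E b (\<lambda>s. vset {f (proj b a s), g (proj b a s)})"
      "val E a f = val E b (\<lambda>s. f (proj b a s))" "val E a g = val E b (\<lambda>s. g (proj b a s))"
      using val_proj[OF b(1,2), of f] val_proj[OF b(1,2), of g]
        val_proj[OF b(1,2), of "\<lambda>s. vset {f s, g s}"] by simp_all
    then show ?thesis
      by (simp add: b(3) val_mem_iff[OF b(1)] val_eq_iff[OF b(1)] ae_disj[OF b(1)])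
  qed
  have "elts (val E a (\<lambda>s. vset {f s, g s})) = {val E a f, val E a g}"
  proof (intro equalityI subsetI)
    fix x assume x: "x \<in> elts (val E a (\<lambda>s. vset {f s, g s}))"
    then show "x \<in> {val E a f, val E a g}" using mem[OF ult_trans[OF x val_in_ult[OF a]]] by simp
  next
    fix x assume "x \<in> {val E a f, val E a g}"
    then show "x \<in> elts (val E a (\<lambda>s. vset {f s, g s}))"
      using mem[of x] val_in_ult[OF a, of f] val_in_ult[OF a, of g] by auto
  qed
  from arg_cong[OF this, of vset] show ?thesis unfolding vset_elts .
qed

lemma val_kpair:
  assumes a: "a \<in> supports E"
  shows "val E a (\<lambda>s. kpair (f s) (g s)) = kpair (val E a f) (val E a g)"
  using val_upair[OF a, of "\<lambda>s. vset {f s, f s}" "\<lambda>s. vset {f s, g s}"]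
    val_upair[OF a, of f f] val_upair[OF a, of f g] by (simp add: kpair_def)

lemma ult_emb_val: "a \<in> supports E \<Longrightarrow> ult_emb E x = val E a (\<lambda>_. x)"
  unfolding ult_emb_def using val_proj[of a "{}" "\<lambda>_. x"] by simp

lemma ult_emb_in_ult: "ult_emb E x \<in> ult E"
  unfolding ult_emb_def by (rule val_in_ult[OF supports_empty])

lemma ult_emb_mem: "x \<in> elts y \<Longrightarrow> ult_emb E x \<in> elts (ult_emb E y)"
  unfolding ult_emb_def val_mem_iff[OF supports_empty] by (rule ae_all[OF supports_empty])

text \<open>Constant functions would carry a descending sequence of sets into the wellfounded
  \<open>ult_mem E\<close>.\<close>

lemma no_descending_chain: "\<exists>n. x (Suc n) \<notin> elts (x n)" for x :: "nat \<Rightarrow> 'v"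
proof (rule ccontr)
  assume "\<not> ?thesis"
  then have "ult_mem E ({}, \<lambda>_. x (Suc n)) ({}, \<lambda>_. x n)" for n
    unfolding ult_mem_same[OF supports_empty] by (intro ae_all[OF supports_empty]) simp
  then show False using no_ult_chain[of "\<lambda>n. ({}, \<lambda>_. x n)"] by simp
qed

section \<open>Threads through increasing supports\<close>

lemma ae_all_le:
  fixes k :: nat
  assumes a: "a \<in> supports E" and "\<And>i. i \<le> k \<Longrightarrow> ae E a (Q i)"
  shows "ae E a (\<lambda>s. \<forall>i\<le>k. Q i s)"
  using assms(2)
proof (induction k)
  case 0
  then have "ae E a (Q 0)" by simp
  then show ?case by (rule ae_mono[OF a]) simp
next
  case (Suc k)
  then have "ae E a (\<lambda>s. \<forall>i\<le>k. Q i s)" "ae E a (Q (Suc k))" by simp_all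
  from ae_conj[OF a this] show ?case by (rule ae_mono[OF a]) (auto simp: le_Suc_eq)
qed

text \<open>If there were no thread, the ranks of the tree of its finite approximations would form a
  descending sequence in the ultrapower.\<close>

lemma thread_exists:
  assumes c: "\<And>k. c k \<in> supports E" and c_mono: "mono c" and T: "\<And>k. ae E (c k) (T k)"
  shows "\<exists>s. \<forall>k. s k \<in> points E (c k) \<and> T k (s k) \<and> s k = proj (c (Suc k)) (c k) (s (Suc k))"
proof (rule ccontr)
  assume no: "\<not> ?thesis"
  define good where "good k s \<longleftrightarrow> s \<in> points E (c k) \<and> (\<forall>i\<le>k. T i (proj (c k) (c i) s))" for k s
  define R where "R = {((Suc k, s'), (k, s)) |k s' s. good (Suc k) s' \<and> s = proj (c (Suc k)) (c k) s'}"
  have sub: "i \<le> k \<Longrightarrow> c i \<subseteq> c k" for i k using c_mono by (auto dest: monoD)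
  have "wf R"
  proof (rule ccontr)
    assume "\<not> wf R"
    then obtain f where f: "\<And>i. (f (Suc i), f i) \<in> R" unfolding wf_iff_no_infinite_down_chain by blast
    \<comment> \<open>The descent may start at any level. It is read from \<open>f 1\<close> on,
      since \<open>R\<close> records goodness only for its first component.\<close>
    define k0 t where "k0 = fst (f 1)" and "t i = snd (f (Suc i))" for i
    have fst: "fst (f (Suc i)) = k0 + i" for i
    proof (induction i)
      case (Suc i)
      then show ?case using f[of "Suc i"] unfolding R_def by auto
    qed (simp add: k0_def)
    have f_eq: "f (Suc i) = (k0 + i, t i)" for i using fst[of i] by (simp add: t_def prod_eq_iff)
    have good: "good (k0 + i) (t i)" for i using f[of i] unfolding f_eq R_def by auto
    have step: "t i = proj (c (k0 + Suc i)) (c (k0 + i)) (t (Suc i))" for i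
      using f[of "Suc i"] unfolding f_eq R_def by auto
    \<comment> \<open>Projecting from level \<open>k0 + i\<close> down to level \<open>i\<close>
      supplies the missing first levels of the thread.\<close>
    define s where "s i = proj (c (k0 + i)) (c i) (t i)" for i
    have "s i \<in> points E (c i) \<and> T i (s i) \<and> s i = proj (c (Suc i)) (c i) (s (Suc i))" for i
    proof (intro conjI)
      have t: "t j \<in> points E (c (k0 + j))" for j using good[of j] by (simp add: good_def)
      show "s i \<in> points E (c i)" unfolding s_def by (rule points_proj[OF c t sub]) simp
      show "T i (s i)" using good[of i] unfolding good_def s_def by simp
      have "s i = proj (c (k0 + Suc i)) (c i) (t (Suc i))"
        unfolding s_def by (subst step, rule proj_comp[OF c t]) (simp_all add: sub)
      moreover have "proj (c (Suc i)) (c i) (s (Suc i)) = proj (c (k0 + Suc i)) (c i) (t (Suc i))"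
        unfolding s_def by (rule proj_comp[OF c t]) (simp_all add: sub)
      ultimately show "s i = proj (c (Suc i)) (c i) (s (Suc i))" by simp
    qed
    with no show False by blast
  qed
  \<comment> \<open>A rank of nodes: the set of the ranks of the children. Children of a node are
    points one level up, so they range over a set.\<close>
  define \<rho> :: "nat \<times> 'v set \<Rightarrow> 'v" where "\<rho> = wfrec R (\<lambda>\<rho> q. vset (\<rho> ` {p. (p, q) \<in> R}))"
  have rec: "\<rho> q = vset (\<rho> ` {p. (p, q) \<in> R})" for q
  proof -
    have "\<rho> q = vset (cut \<rho> R q ` {p. (p, q) \<in> R})"
      unfolding \<rho>_def by (subst wfrec[OF \<open>wf R\<close>]) (rule refl)
    also have "cut \<rho> R q ` {p. (p, q) \<in> R} = \<rho> ` {p. (p, q) \<in> R}"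
      by (intro image_cong refl) (simp add: cut_apply)
    finally show ?thesis .
  qed
  have small: "small (\<rho> ` {p. (p, q) \<in> R})" for q :: "nat \<times> 'v set"
  proof -
    have "\<rho> ` {p. (p, q) \<in> R} \<subseteq> (\<lambda>u. \<rho> (Suc (fst q), elts u)) ` elts (pow (ext_space E))"
    proof (intro image_subsetI)
      fix p assume "p \<in> {p. (p, q) \<in> R}"
      then obtain s where p: "p = (Suc (fst q), s)" and s: "s \<in> points E (c (Suc (fst q)))"
        unfolding R_def good_def by auto
      then show "\<rho> p \<in> (\<lambda>u. \<rho> (Suc (fst q), elts u)) ` elts (pow (ext_space E))"
        using points_vset[OF s] elts_vset[OF points_small[OF s]]
        by (intro image_eqI[of _ _ "vset s"]) simp_all
    qed
    then show ?thesis
      by (rule small_subset[OF small_image[OF small_elts, of "\<lambda>u. \<rho> (Suc (fst q), elts u)"]])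
  qed
  have "ult_mem E (c (Suc k), \<lambda>s. \<rho> (Suc k, s)) (c k, \<lambda>s. \<rho> (k, s))" for k
  proof -
    have "ae E (c (Suc k)) (\<lambda>s. \<forall>i\<le>Suc k. T i (proj (c (Suc k)) (c i) s))"
      by (rule ae_all_le[OF c]) (simp add: ae_proj[OF c sub] T)
    then have "ae E (c (Suc k)) (\<lambda>s. \<rho> (Suc k, s) \<in> elts (\<rho> (k, proj (c (Suc k)) (c k) s)))"
    proof (rule ae_mono[OF c])
      fix s assume "s \<in> points E (c (Suc k))" "\<forall>i\<le>Suc k. T i (proj (c (Suc k)) (c i) s)"
      then have "((Suc k, s), (k, proj (c (Suc k)) (c k) s)) \<in> R" unfolding R_def good_def by blast
      then show "\<rho> (Suc k, s) \<in> elts (\<rho> (k, proj (c (Suc k)) (c k) s))"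
        unfolding rec[of "(k, _)"] elts_vset[OF small] by blast
    qed
    then have "ult_mem E (c (Suc k), \<lambda>s. \<rho> (Suc k, s))
        (c (Suc k), \<lambda>s. \<rho> (k, proj (c (Suc k)) (c k) s))"
      by (rule ult_mem_same[OF c, THEN iffD2])
    then show ?thesis
      by (rule ult_mem_proj_right[OF c sub, where f = "\<lambda>s. \<rho> (k, s)", THEN iffD1, rotated]) simp
  qed
  then show False using no_ult_chain[of "\<lambda>k. (c k, \<lambda>s. \<rho> (k, s))"] by simp
qed

text \<open>By composition of projections, a thread shows the same coordinates in \<open>b\<close>
  at every level from \<open>k\<close> on.\<close>

lemma proj_thread:
  assumes c: "\<And>k. c k \<in> supports E" and c_mono: "mono c"
    and s: "\<And>k. s k \<in> points E (c k)" "\<And>k. s k = proj (c (Suc k)) (c k) (s (Suc k))"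
    and "b \<subseteq> c k" "k \<le> l"
  shows "proj (c l) b (s l) = proj (c k) b (s k)"
  using \<open>k \<le> l\<close>
proof (induction l rule: dec_induct)
  case (step l)
  have "b \<subseteq> c l" using monoD[OF c_mono step(1)] \<open>b \<subseteq> c k\<close> by blast
  moreover have "c l \<subseteq> c (Suc l)" using monoD[OF c_mono, of l "Suc l"] by simp
  ultimately have "proj (c l) b (proj (c (Suc l)) (c l) (s (Suc l))) = proj (c (Suc l)) b (s (Suc l))"
    by (rule proj_comp[OF c s(1)])
  then show ?case using s(2)[of l] step.IH by simp
qed simp

text \<open>Reflects an infinite chain of the ultrapower at a single point. A finite support need
  not represent the whole chain, so step \<open>k\<close> lives on a support growing with
  \<open>k\<close>, and a thread through these fixes \<open>s\<close> and all \<open>u k\<close>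
  together.\<close>

lemma realize_chain:
  assumes a: "a \<in> supports E" and Q: "ae E a Q" and x: "\<And>k. x k \<in> ult E"
    and C: "\<And>k. kpair (x k) (x (Suc k)) \<in> elts (val E a (C k))"
  shows "\<exists>s\<in>points E a. Q s \<and> (\<exists>u. \<forall>k. kpair (u k) (u (Suc k)) \<in> elts (C k s))"
proof -
  have "\<forall>k. \<exists>b g. b \<in> supports E \<and> x k = val E b g" using ult_rep[OF x] by blast
  then obtain b g where b: "\<And>k. b k \<in> supports E" and x_eq: "\<And>k. x k = val E (b k) (g k)" by metis
  \<comment> \<open>Step \<open>k\<close> mentions \<open>x k\<close> and \<open>x (Suc k)\<close>,
    hence the bound \<open>Suc k\<close>. Including \<open>a\<close> makes all levels project to one
    point of support \<open>a\<close>.\<close>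
  define c where "c k = a \<union> (\<Union>i\<le>Suc k. b i)" for k
  have c: "c k \<in> supports E" for k using a b unfolding c_def Fpow_def by auto
  have c_mono: "mono c" unfolding mono_def c_def by fastforce
  have sub: "a \<subseteq> c k" "b k \<subseteq> c k" "b (Suc k) \<subseteq> c k" for k unfolding c_def by auto
  define T where "T k t \<longleftrightarrow> kpair (g k (proj (c k) (b k) t)) (g (Suc k) (proj (c k) (b (Suc k)) t))
    \<in> elts (C k (proj (c k) a t)) \<and> Q (proj (c k) a t)" for k t
  have T: "ae E (c k) (T k)" for k
  proof -
    have "x k = val E (c k) (\<lambda>t. g k (proj (c k) (b k) t))"
      "x (Suc k) = val E (c k) (\<lambda>t. g (Suc k) (proj (c k) (b (Suc k)) t))"
      unfolding x_eq by (rule val_proj[OF c sub(2), symmetric], rule val_proj[OF c sub(3), symmetric])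
    moreover have "val E a (C k) = val E (c k) (\<lambda>t. C k (proj (c k) a t))"
      by (rule val_proj[OF c sub(1), symmetric])
    ultimately have "ae E (c k) (\<lambda>t. kpair (g k (proj (c k) (b k) t))
        (g (Suc k) (proj (c k) (b (Suc k)) t)) \<in> elts (C k (proj (c k) a t)))"
      using C[of k] by (simp add: val_kpair[OF c, symmetric] val_mem_iff[OF c])
    moreover have "ae E (c k) (\<lambda>t. Q (proj (c k) a t))" using ae_proj[OF c sub(1), where Q = Q] Q by simp
    ultimately show ?thesis unfolding T_def by (rule ae_conj[OF c])
  qed
  obtain s where s: "\<And>k. s k \<in> points E (c k)" "\<And>k. T k (s k)"
      "\<And>k. s k = proj (c (Suc k)) (c k) (s (Suc k))"
    using thread_exists[OF c c_mono T] by blast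
  note proj = proj_thread[OF c c_mono s(1,3)]
  define s0 where "s0 = proj (c 0) a (s 0)"
  define u where "u k = g k (proj (c k) (b k) (s k))" for k
  have s0: "proj (c k) a (s k) = s0" for k unfolding s0_def by (rule proj[OF sub(1)]) simp
  have u: "g (Suc k) (proj (c k) (b (Suc k)) (s k)) = u (Suc k)" for k
    using proj[OF sub(3)[of k], of "Suc k"] by (simp add: u_def)
  have "kpair (u k) (u (Suc k)) \<in> elts (C k s0) \<and> Q s0" for k
    using s(2)[of k] unfolding T_def s0 u by (simp add: u_def)
  then have "\<forall>k. kpair (u k) (u (Suc k)) \<in> elts (C k s0)" and "Q s0" by simp_all
  moreover have "s0 \<in> points E a" unfolding s0_def by (rule points_proj[OF c s(1) sub(1)])
  ultimately show ?thesis by (intro bexI[of _ s0] conjI exI[of _ u])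
qed

lemma ult_kpairD:
  assumes "kpair x y \<in> elts z" "z \<in> ult E" shows "x \<in> ult E" "y \<in> ult E"
proof -
  have "vset {x, y} \<in> elts (kpair x y)" unfolding kpair_def by simp
  then have "vset {x, y} \<in> ult E" by (rule ult_trans[OF _ ult_trans[OF assms]])
  then show "x \<in> ult E" "y \<in> ult E" by (rule ult_trans[rotated], simp)+
qed

text \<open>One direction of Los's theorem for an existential quantifier. The witness
  \<open>y\<close> may need a larger support, but once it is quantified out only coordinates in
  \<open>a\<close> matter.\<close>

lemma ae_ex_witness:
  assumes a: "a \<in> supports E" and y: "y \<in> ult E"
    and fy: "kpair (val E a f) y \<in> elts (val E a g)"
    and pq: "kpair (val E a p) (val E a q) \<in> elts y"
  shows "ae E a (\<lambda>s. \<exists>D. kpair (f s) D \<in> elts (g s) \<and> kpair (p s) (q s) \<in> elts D)"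
proof -
  obtain b D where b: "b \<in> supports E" and ab: "a \<subseteq> b" and y_eq: "y = val E b D"
    using ult_rep_above[OF y a] by blast
  note lift = val_proj[OF b ab, symmetric]
  have "ae E b (\<lambda>s. kpair (f (proj b a s)) (D s) \<in> elts (g (proj b a s)))"
    using fy unfolding y_eq lift[of f] lift[of g] val_kpair[OF b, symmetric] val_mem_iff[OF b] .
  moreover have "ae E b (\<lambda>s. kpair (p (proj b a s)) (q (proj b a s)) \<in> elts (D s))"
    using pq unfolding y_eq lift[of p] lift[of q] val_kpair[OF b, symmetric] val_mem_iff[OF b] .
  ultimately have "ae E b (\<lambda>s. \<exists>D. kpair (f (proj b a s)) D \<in> elts (g (proj b a s))
      \<and> kpair (p (proj b a s)) (q (proj b a s)) \<in> elts D)"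
    by (rule ae_mono[OF b ae_conj[OF b]]) blast
  then show ?thesis
    using ae_proj[OF b ab, of "\<lambda>s. \<exists>D. kpair (f s) D \<in> elts (g s) \<and> kpair (p s) (q s) \<in> elts D"]
    by simp
qed

end

section \<open>The internal relation\<close>

lemma elts_ult_emb_restrict:
  "elts (ult_emb_restrict E x) = (\<lambda>y. kpair y (ult_emb E y)) ` elts x"
  unfolding ult_emb_restrict_def by (intro elts_vset small_image small_elts)

lemma elts_sup_image:
  "elts (sup_image E \<alpha>) = (\<Union>\<xi>\<in>elts \<alpha>. insert (ult_emb E \<xi>) (elts (ult_emb E \<xi>)))"
  unfolding sup_image_def by (intro elts_vset small_UN small_insert small_elts)

text \<open>The restriction of the embedding to the singleton of \<open>y\<close> consists of one
  pair, and transitivity of \<open>ult F\<close> extracts its second component.\<close>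

lemma internal_ult_emb:
  assumes F: "extender F" and int: "internal E F" and y: "y \<in> ult F"
  shows "ult_emb E y \<in> ult F"
proof -
  obtain a f where a: "a \<in> supports F" "y = val F a f" using ult_rep[OF F y] by blast
  define x where "x = val F a (\<lambda>s. vset {f s, f s})"
  have "elts x = {y}" unfolding x_def val_upair[OF F a(1)] a(2) by simp
  then have "kpair y (ult_emb E y) \<in> elts (ult_emb_restrict E x)"
    unfolding elts_ult_emb_restrict by simp
  moreover have "ult_emb_restrict E x \<in> ult F"
    using int val_in_ult[OF F a(1)] unfolding internal_def x_def by blast
  ultimately show ?thesis by (rule ult_kpairD[OF F])
qed

text \<open>Countable completeness of the extender derived from \<open>R\<close>. The set \<open>C k\<close> is a binary relation, and
  \<open>y\<close> is a path through the relations that \<open>R\<close> assigns to them.\<close>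

definition realizes_chains :: "'v::zfc_universe \<Rightarrow> bool"
  where "realizes_chains R \<longleftrightarrow> (\<forall>C y.
    (\<forall>k::nat. \<exists>D. kpair (C k) D \<in> elts R \<and> kpair (y k) (y (Suc k)) \<in> elts D) \<longrightarrow>
    (\<exists>u. \<forall>k. kpair (u k) (u (Suc k)) \<in> elts (C k)))"

text \<open>A counterexample chosen for almost every \<open>s\<close> gives a chain in the ultrapower by \<open>E\<close>. It is
  realized first along \<open>E\<close>, by elements of the ultrapower by \<open>F\<close>, and these are then realized along
  \<open>F\<close>.\<close>

lemma ae_realizes_chains:
  assumes E: "extender E" and F: "extender F" and x: "x \<in> ult F"
    and a: "a \<in> supports F" and r: "ult_emb_restrict E x = val F a r"
  shows "ae F a (\<lambda>s. realizes_chains (r s))"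
proof (rule ccontr)
  assume "\<not> ?thesis"
  then have neg: "ae F a (\<lambda>s. \<not> realizes_chains (r s))"
    by (rule ae_not[OF F a, THEN iffD2])
  have "\<forall>s. \<exists>C y D. \<not> realizes_chains (r s) \<longrightarrow>
      (\<forall>k::nat. kpair (C k) (D k) \<in> elts (r s) \<and> kpair (y k) (y (Suc k)) \<in> elts (D k)) \<and>
      \<not> (\<exists>u. \<forall>k. kpair (u k) (u (Suc k)) \<in> elts (C k))"
  proof
    fix s
    show "\<exists>C y D. \<not> realizes_chains (r s) \<longrightarrow>
      (\<forall>k::nat. kpair (C k) (D k) \<in> elts (r s) \<and> kpair (y k) (y (Suc k)) \<in> elts (D k)) \<and>
      \<not> (\<exists>u. \<forall>k. kpair (u k) (u (Suc k)) \<in> elts (C k))"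
    proof (cases "realizes_chains (r s)")
      case False
      then obtain C y where "\<forall>k::nat. \<exists>D. kpair (C k) D \<in> elts (r s) \<and> kpair (y k) (y (Suc k)) \<in> elts D"
        and no: "\<not> (\<exists>u. \<forall>k. kpair (u k) (u (Suc k)) \<in> elts (C k))"
        unfolding realizes_chains_def by blast
      from Hilbert_Choice.choice[OF this(1)] obtain D where
        "\<forall>k. kpair (C k) (D k) \<in> elts (r s) \<and> kpair (y k) (y (Suc k)) \<in> elts (D k)" ..
      with no show ?thesis by blast
    qed blast
  qed
  from Hilbert_Choice.choice[OF this] obtain C where "\<forall>s. \<exists>y D. \<not> realizes_chains (r s) \<longrightarrow>
      (\<forall>k::nat. kpair (C s k) (D k) \<in> elts (r s) \<and> kpair (y k) (y (Suc k)) \<in> elts (D k)) \<and>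
      \<not> (\<exists>u. \<forall>k. kpair (u k) (u (Suc k)) \<in> elts (C s k))" ..
  from Hilbert_Choice.choice[OF this] obtain y where "\<forall>s. \<exists>D. \<not> realizes_chains (r s) \<longrightarrow>
      (\<forall>k::nat. kpair (C s k) (D k) \<in> elts (r s) \<and> kpair (y s k) (y s (Suc k)) \<in> elts (D k)) \<and>
      \<not> (\<exists>u. \<forall>k. kpair (u k) (u (Suc k)) \<in> elts (C s k))" ..
  from Hilbert_Choice.choice[OF this] obtain D where bad: "\<forall>s. \<not> realizes_chains (r s) \<longrightarrow>
      (\<forall>k::nat. kpair (C s k) (D s k) \<in> elts (r s) \<and> kpair (y s k) (y s (Suc k)) \<in> elts (D s k)) \<and>
      \<not> (\<exists>u. \<forall>k. kpair (u k) (u (Suc k)) \<in> elts (C s k))" ..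
  define C' where "C' k = val F a (\<lambda>s. C s k)" for k
  define y' where "y' k = val F a (\<lambda>s. y s k)" for k
  define D' where "D' k = val F a (\<lambda>s. D s k)" for k
  have CD: "kpair (C' k) (D' k) \<in> elts (ult_emb_restrict E x)" for k
    unfolding r C'_def D'_def val_kpair[OF F a, symmetric] val_mem_iff[OF F a]
    using neg by (rule ae_mono[OF F a]) (simp add: bad)
  \<comment> \<open>These pairs belong to the actual restriction, so the set attached to
    \<open>C' k\<close> can only be its image.\<close>
  have "C' k \<in> elts x \<and> D' k = ult_emb E (C' k)" for k
    using CD[of k] unfolding elts_ult_emb_restrict by (elim imageE) simp
  then have C'x: "C' k \<in> elts x" and D': "D' k = ult_emb E (C' k)" for k by simp_all
  have yD: "kpair (y' k) (y' (Suc k)) \<in> elts (D' k)" for k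
    unfolding y'_def D'_def val_kpair[OF F a, symmetric] val_mem_iff[OF F a]
    using neg by (rule ae_mono[OF F a]) (simp add: bad)
  have y'E: "y' k \<in> ult E" for k
    using ult_kpairD(1)[OF E yD] ult_emb_in_ult[OF E] unfolding D' .
  \<comment> \<open>The image of \<open>C' k\<close> is represented by a constant function on the
    empty support, so realizing along \<open>E\<close> returns a path through the relations
    \<open>C' k\<close> themselves.\<close>
  have "\<exists>s\<in>points E {}. True \<and> (\<exists>u. \<forall>k. kpair (u k) (u (Suc k)) \<in> elts (C' k))"
  proof (rule realize_chain[OF E supports_empty _ y'E])
    show "ae E {} (\<lambda>_. True)" by (rule ae_all[OF E supports_empty]) simp
    show "kpair (y' k) (y' (Suc k)) \<in> elts (val E {} (\<lambda>_. C' k))" for k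
      using yD[of k] unfolding D' ult_emb_def .
  qed
  then obtain v where v: "\<And>k. kpair (v k) (v (Suc k)) \<in> elts (C' k)" by blast
  have "v k \<in> ult F" for k by (rule ult_kpairD(1)[OF F v ult_trans[OF F C'x x]])
  then have "\<exists>s\<in>points F a. \<not> realizes_chains (r s) \<and>
      (\<exists>u. \<forall>k. kpair (u k) (u (Suc k)) \<in> elts (C s k))"
    by (rule realize_chain[OF F a neg, where x = v and C = "\<lambda>k s. C s k"])
      (rule v[unfolded C'_def])
  then obtain s where s: "\<not> realizes_chains (r s)"
    and u: "\<exists>u. \<forall>k. kpair (u k) (u (Suc k)) \<in> elts (C s k)" by (elim bexE conjE)
  from bad[THEN spec, of s, THEN mp, OF s, THEN conjunct2] u show False by (rule notE)
qed

section \<open>The descending sequence along an internal chain\<close>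

lemma choice3:
  "(\<And>n. \<exists>a b c. P n a b c) \<Longrightarrow> \<exists>a b c. \<forall>n. P n (a n) (b n) (c n)"
  by metis

lemma no_discontinuous_internal_chain:
  fixes E :: "nat \<Rightarrow> 'v::zfc_universe ext_system"
  assumes ext: "\<And>n. extender (E n)" and disc: "\<And>n. discontinuous_at (E n) \<alpha>"
    and int: "\<And>n. internal (E (Suc n)) (E n)"
  shows False
proof -
  define j where "j n = ult_emb (E n)" for n
  define \<epsilon> where "\<epsilon> n = sup_image (E n) \<alpha>" for n
  define Pt where "Pt n = pow (ext_space (E n))" for n
  \<comment> \<open>Large enough to contain the class of every function whose values are binary
    relations on codes of points of level \<open>Suc n\<close>. Thus \<open>R n\<close> applies to
    all the relations used below.\<close>
  define x where "x n = j n (pow (product (Pt (Suc n)) (Pt (Suc n))))" for n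
  define R where "R n = ult_emb_restrict (E (Suc n)) (x n)" for n
  have \<epsilon>: "\<epsilon> n \<in> elts (j n \<alpha>)" for n
    using disc unfolding discontinuous_at_def \<epsilon>_def j_def .
  have j_ult: "j n y \<in> ult (E n)" for n y unfolding j_def by (rule ult_emb_in_ult[OF ext])
  have \<epsilon>_ult: "\<epsilon> n \<in> ult (E n)" for n by (rule ult_trans[OF ext \<epsilon> j_ult])
  have x_ult: "x n \<in> ult (E n)" for n unfolding x_def by (rule j_ult)
  have R_ult: "R n \<in> ult (E n)" for n
    using int x_ult unfolding internal_def R_def by blast
  have "\<exists>a e r. a \<in> supports (E n) \<and> \<epsilon> n = val (E n) a e \<and> R n = val (E n) a r" for n
  proof -
    obtain b e where b: "b \<in> supports (E n)" "\<epsilon> n = val (E n) b e"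
      using ult_rep[OF ext \<epsilon>_ult[of n]] by (elim exE conjE)
    obtain a r where a: "a \<in> supports (E n)" "b \<subseteq> a" "R n = val (E n) a r"
      using ult_rep_above[OF ext R_ult[of n] b(1)] by (elim exE conjE)
    have "\<epsilon> n = val (E n) a (\<lambda>s. e (proj a b s))" unfolding b(2) val_proj[OF ext a(1,2)] ..
    with a(1,3) show ?thesis
      by (intro exI[of _ a] exI[of _ "\<lambda>s. e (proj a b s)"] exI[of _ r] conjI)
  qed
  from choice3[of "\<lambda>n a e r. a \<in> supports (E n) \<and> \<epsilon> n = val (E n) a e \<and> R n = val (E n) a r", OF this]
  obtain a e r where aer: "\<forall>n. a n \<in> supports (E n) \<and> \<epsilon> n = val (E n) (a n) (e n)
      \<and> R n = val (E n) (a n) (r n)" by (elim exE)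
  have a: "a n \<in> supports (E n)" for n by (rule aer[THEN spec, THEN conjunct1])
  have e: "\<epsilon> n = val (E n) (a n) (e n)" for n
    by (rule aer[THEN spec, THEN conjunct2, THEN conjunct1])
  have r: "R n = val (E n) (a n) (r n)" for n
    by (rule aer[THEN spec, THEN conjunct2, THEN conjunct2])
  \<comment> \<open>A fixed choice of representatives, made for every \<open>y\<close> because the
    recursion defining the supports precedes the proof that the sets concerned lie in
    \<open>ult (E n)\<close>.\<close>
  define B where "B n y = (SOME b. b \<in> supports (E n) \<and> (\<exists>g. y = val (E n) b g))" for n y
  define G where "G n y = (SOME g. y = val (E n) (B n y) g)" for n y
  have B: "B n y \<in> supports (E n)" and G: "y = val (E n) (B n y) (G n y)" if y: "y \<in> ult (E n)" for n y
  proof -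
    obtain b g where "b \<in> supports (E n)" "y = val (E n) b g"
      using ult_rep[OF ext y] by (elim exE conjE)
    then have "b \<in> supports (E n) \<and> (\<exists>g. y = val (E n) b g)" by (intro conjI exI[of _ g])
    then have *: "B n y \<in> supports (E n) \<and> (\<exists>g. y = val (E n) (B n y) g)"
      unfolding B_def by (rule someI)
    then show "B n y \<in> supports (E n)" by (rule conjunct1)
    from *[THEN conjunct2] show "y = val (E n) (B n y) (G n y)" unfolding G_def by (rule someI_ex)
  qed
  \<comment> \<open>\<open>\<eta> k n\<close> is the image under \<open>j\<^sub>n\<^sub>+\<^sub>1(j\<^sub>n)\<close> of the \<open>k\<close>-th seed of \<open>E\<^sub>n\<^sub>+\<^sub>1\<close>, and \<open>c (Suc k) n\<close> supports it.\<close>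
  define c where "c = rec_nat a (\<lambda>k c n. c n \<union> B n (val (E (Suc n)) (c (Suc n)) (\<lambda>t. j n (vset t))))"
  define \<eta> where "\<eta> k n = val (E (Suc n)) (c k (Suc n)) (\<lambda>t. j n (vset t))" for k n
  have c_0: "c 0 n = a n" for n by (simp add: c_def)
  have c_Suc: "c (Suc k) n = c k n \<union> B n (\<eta> k n)" for k n by (simp add: c_def \<eta>_def)
  \<comment> \<open>All values of the representing function on points lie in
    \<open>j n (Pt (Suc n))\<close>, so \<open>\<eta> k n\<close> belongs to the image of that set
    under the next embedding, and internality puts this image into \<open>ult (E n)\<close>.\<close>
  have \<eta>_ult: "\<eta> k n \<in> ult (E n)" if c: "c k (Suc n) \<in> supports (E (Suc n))" for k n
  proof -
    have "\<eta> k n \<in> elts (ult_emb (E (Suc n)) (j n (Pt (Suc n))))"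
      unfolding \<eta>_def ult_emb_val[OF ext c] val_mem_iff[OF ext c]
    proof (rule ae_all[OF ext c])
      fix s assume "s \<in> points (E (Suc n)) (c k (Suc n))"
      then show "j n (vset s) \<in> elts (j n (Pt (Suc n)))"
        unfolding j_def Pt_def by (intro ult_emb_mem[OF ext] points_vset[OF ext])
    qed
    then show ?thesis
      by (rule ult_trans[OF ext _ internal_ult_emb[OF ext int j_ult]])
  qed
  have c_sup: "c k n \<in> supports (E n)" for k n
  proof (induction k arbitrary: n)
    case 0
    then show ?case unfolding c_0 by (rule a)
  next
    case (Suc k)
    show ?case unfolding c_Suc by (rule supports_Un[OF Suc B[OF \<eta>_ult[OF Suc]]])
  qed
  have c_mono: "mono (\<lambda>k. c k n)" for n unfolding mono_iff_le_Suc c_Suc by blast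
  have sub: "i \<le> k \<Longrightarrow> c i n \<subseteq> c k n" for i k n using monoD[OF c_mono] .
  define h where "h k n s = G n (\<eta> k n) (proj (c (Suc k) n) (B n (\<eta> k n)) s)" for k n s
  have h: "\<eta> k n = val (E n) (c (Suc k) n) (h k n)" for k n
  proof -
    have "B n (\<eta> k n) \<subseteq> c (Suc k) n" unfolding c_Suc by blast
    from val_proj[OF ext c_sup this] show ?thesis
      unfolding h_def using G[OF \<eta>_ult[OF c_sup], of k n] by simp
  qed
  \<comment> \<open>A link joins an approximation to a one-step extension \<open>t\<close> that
    satisfies \<open>L\<close> and has its ordinal below \<open>\<beta>\<close>. A path through such
    relations for all \<open>k\<close> is a thread with a smaller ordinal.\<close>
  define CC where "CC k n L \<beta> = vset {kpair (vset (proj (c (Suc k) n) (c k n) t)) (vset t) |t.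
      t \<in> points (E n) (c (Suc k) n) \<and> L t \<and> e n (proj (c (Suc k) n) (c 0 n) t) \<in> elts \<beta>}"
    for k n L \<beta>
  have CC_sub: "{kpair (vset (proj (c (Suc k) n) (c k n) t)) (vset t) |t.
      t \<in> points (E n) (c (Suc k) n) \<and> L t \<and> e n (proj (c (Suc k) n) (c 0 n) t) \<in> elts \<beta>}
      \<subseteq> elts (product (Pt n) (Pt n))" for k n L \<beta>
  proof (intro subsetI, elim CollectE exE conjE)
    fix z t assume z: "z = kpair (vset (proj (c (Suc k) n) (c k n) t)) (vset t)"
      and t: "t \<in> points (E n) (c (Suc k) n)"
    have "proj (c (Suc k) n) (c k n) t \<in> points (E n) (c k n)"
      by (rule points_proj[OF ext c_sup t sub]) simp
    then show "z \<in> elts (product (Pt n) (Pt n))"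
      unfolding z elts_product Pt_def using points_vset[OF ext] t by blast
  qed
  have elts_CC: "elts (CC k n L \<beta>) = {kpair (vset (proj (c (Suc k) n) (c k n) t)) (vset t) |t.
      t \<in> points (E n) (c (Suc k) n) \<and> L t \<and> e n (proj (c (Suc k) n) (c 0 n) t) \<in> elts \<beta>}"
    for k n L \<beta> unfolding CC_def by (rule elts_vset[OF small_subset[OF small_elts CC_sub]])
  have CC_pow: "CC k n L \<beta> \<in> elts (pow (product (Pt n) (Pt n)))" for k n L \<beta>
    unfolding elts_pow mem_Collect_eq elts_CC by (rule CC_sub)
  \<comment> \<open>The pointwise form of \<open>kpair (\<eta> k n) (\<eta> (Suc k) n) \<in> elts (j
    (Suc n) A)\<close>, with \<open>A\<close> the class of the relations \<open>CC\<close>: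
    \<open>r\<close> represents the restricted embedding, \<open>h\<close> represents the
    \<open>\<eta>\<close>, and \<open>D\<close> stands for the image of \<open>A\<close>.\<close>
  define step where "step k n L s \<longleftrightarrow> (\<exists>D.
      kpair (CC k (Suc n) L (e n (proj (c (Suc (Suc k)) n) (c 0 n) s))) D
        \<in> elts (r n (proj (c (Suc (Suc k)) n) (c 0 n) s)) \<and>
      kpair (h k n (proj (c (Suc (Suc k)) n) (c (Suc k) n) s)) (h (Suc k) n s) \<in> elts D)"
    for k n L s
  \<comment> \<open>\<open>L k n\<close> looks \<open>k\<close> levels ahead and concerns points for
    \<open>c (Suc k) n\<close>. Each recursion step consults level \<open>Suc n\<close>, so all
    \<open>n\<close> are treated at once; the base case records completeness.\<close>
  define L where "L = rec_nat (\<lambda>n s. realizes_chains (r n (proj (c 1 n) (c 0 n) s)))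
      (\<lambda>k L n. step k n (L (Suc n)))"
  have L_0: "L 0 n s \<longleftrightarrow> realizes_chains (r n (proj (c 1 n) (c 0 n) s))" for n s
    by (simp add: L_def)
  have L_Suc: "L (Suc k) n = step k n (L k (Suc n))" for k n by (simp add: L_def)
  have L: "ae (E n) (c (Suc k) n) (L k n)" for k n
  proof (induction k arbitrary: n)
    case 0
    have "ae (E n) (c 0 n) (\<lambda>s. realizes_chains (r n s))"
      using ae_realizes_chains[OF ext ext x_ult a, of "Suc n" n "r n"] r[of n]
      unfolding R_def c_0 by simp
    then show ?case unfolding L_0 One_nat_def
      by (rule ae_proj[OF ext c_sup sub, THEN iffD2, rotated]) simp
  next
    case (Suc k)
    define d b where "d = c (Suc (Suc k)) n" and "b = c (Suc k) (Suc n)"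
    have d: "d \<in> supports (E n)" and b: "b \<in> supports (E (Suc n))"
      unfolding d_def b_def by (rule c_sup)+
    have sub_d: "c 0 n \<subseteq> d" "c (Suc k) n \<subseteq> d" unfolding d_def by (rule sub, simp)+
    have sub_b: "c 0 (Suc n) \<subseteq> b" "c k (Suc n) \<subseteq> b" unfolding b_def by (rule sub, simp)+
    \<comment> \<open>The relation \<open>CC\<close> as seen in \<open>ult (E n)\<close>, with bound
      \<open>\<epsilon> n\<close>.\<close>
    define A where "A = val (E n) d (\<lambda>s. CC k (Suc n) (L k (Suc n)) (e n (proj d (c 0 n) s)))"
    have "A \<in> elts (x n)"
      unfolding x_def j_def A_def ult_emb_val[OF ext d] val_mem_iff[OF ext d]
      by (rule ae_all[OF ext d]) (rule CC_pow)
    then have AR: "kpair A (j (Suc n) A) \<in> elts (R n)"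
      unfolding R_def elts_ult_emb_restrict j_def by (rule imageI)
    have \<epsilon>_d: "\<epsilon> n = val (E n) d (\<lambda>s. e n (proj d (c 0 n) s))"
      using val_proj[OF ext d sub_d(1), of "e n"] e[of n] unfolding c_0 by simp
    have \<eta>_b: "\<eta> k n = val (E (Suc n)) b (\<lambda>t. j n (vset (proj b (c k (Suc n)) t)))"
      using val_proj[OF ext b sub_b(2), of "\<lambda>t. j n (vset t)"] unfolding \<eta>_def by simp
    \<comment> \<open>Discontinuity of level \<open>Suc n\<close>, read through Los's
      theorem.\<close>
    have "ae (E (Suc n)) (c 0 (Suc n)) (\<lambda>t. e (Suc n) t \<in> elts \<alpha>)"
      using \<epsilon>[of "Suc n"] unfolding j_def ult_emb_val[OF ext c_sup[of 0]] e
      unfolding c_0[symmetric] val_mem_iff[OF ext c_sup] .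
    then have "ae (E (Suc n)) b (\<lambda>t. e (Suc n) (proj b (c 0 (Suc n)) t) \<in> elts \<alpha>)"
      by (rule ae_proj[OF ext b sub_b(1), where Q = "\<lambda>t. e (Suc n) t \<in> elts \<alpha>", THEN iffD2])
    from ae_conj[OF ext b Suc[of "Suc n", folded b_def] this]
    have "ae (E (Suc n)) b (\<lambda>t. kpair (j n (vset (proj b (c k (Suc n)) t))) (j n (vset t)) \<in> elts A)"
    proof (rule ae_mono[OF ext b], elim conjE)
      fix t assume t: "t \<in> points (E (Suc n)) b" "L k (Suc n) t"
        and "e (Suc n) (proj b (c 0 (Suc n)) t) \<in> elts \<alpha>"
      \<comment> \<open>The supremum at level \<open>n\<close> exceeds the image of every member of
        \<alpha>. This is the source of the descent from one level to the next.\<close>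
      then have "j n (e (Suc n) (proj b (c 0 (Suc n)) t)) \<in> elts (\<epsilon> n)"
        unfolding \<epsilon>_def elts_sup_image j_def by blast
      then have "ae (E n) d (\<lambda>s. e (Suc n) (proj b (c 0 (Suc n)) t) \<in> elts (e n (proj d (c 0 n) s)))"
        unfolding \<epsilon>_d j_def ult_emb_val[OF ext d] val_mem_iff[OF ext d] .
      then have "ae (E n) d (\<lambda>s. kpair (vset (proj b (c k (Suc n)) t)) (vset t)
          \<in> elts (CC k (Suc n) (L k (Suc n)) (e n (proj d (c 0 n) s))))"
        by (rule ae_mono[OF ext d]) (use t in \<open>unfold elts_CC b_def, blast\<close>)
      then show "kpair (j n (vset (proj b (c k (Suc n)) t))) (j n (vset t)) \<in> elts A"
        unfolding j_def A_def ult_emb_val[OF ext d] val_kpair[OF ext d, symmetric]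
          val_mem_iff[OF ext d] .
    qed
    then have "kpair (\<eta> k n) (\<eta> (Suc k) n) \<in> elts (j (Suc n) A)"
      unfolding \<eta>_b unfolding \<eta>_def b_def[symmetric] j_def[of "Suc n"] ult_emb_val[OF ext b]
        val_kpair[OF ext b, symmetric] val_mem_iff[OF ext b] .
    moreover have "\<eta> k n = val (E n) d (\<lambda>s. h k n (proj d (c (Suc k) n) s))"
      using val_proj[OF ext d sub_d(2), of "h k n"] h[of k n] by simp
    moreover have "\<eta> (Suc k) n = val (E n) d (h (Suc k) n)"
      unfolding d_def by (rule h)
    ultimately have hA: "kpair (val (E n) d (\<lambda>s. h k n (proj d (c (Suc k) n) s)))
        (val (E n) d (h (Suc k) n)) \<in> elts (j (Suc n) A)" by simp
    have R_d: "R n = val (E n) d (\<lambda>s. r n (proj d (c 0 n) s))"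
      using val_proj[OF ext d sub_d(1), of "r n"] r[of n] unfolding c_0 by simp
    \<comment> \<open>By internality the image of \<open>A\<close> is available in
      \<open>ult (E n)\<close>, where it serves as the witness \<open>D\<close> of
      \<open>step\<close>.\<close>
    have "j (Suc n) A \<in> ult (E n)"
      unfolding j_def A_def by (rule internal_ult_emb[OF ext int val_in_ult[OF ext d]])
    moreover have "kpair (val (E n) d (\<lambda>s. CC k (Suc n) (L k (Suc n)) (e n (proj d (c 0 n) s))))
        (j (Suc n) A) \<in> elts (val (E n) d (\<lambda>s. r n (proj d (c 0 n) s)))"
      using AR unfolding R_d by (simp only: A_def)
    ultimately show ?case unfolding L_Suc step_def d_def[symmetric]
      using hA by (rule ae_ex_witness[OF ext d])
  qed
  \<comment> \<open>Completeness of \<open>r n (s 0)\<close> turns a thread at level \<open>n\<close> into one at level \<open>n + 1\<close>.\<close>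
  define branch where "branch n s \<longleftrightarrow> (\<forall>k. s k \<in> points (E n) (c k n) \<and>
      s k = proj (c (Suc k) n) (c k n) (s (Suc k)) \<and> L k n (s (Suc k)))" for n s
  have branch_0: "\<exists>s. branch 0 s"
  proof -
    \<comment> \<open>Since \<open>L i\<close> is a condition on support \<open>c (Suc i)\<close>,
      the first member of the thread carries none.\<close>
    have "ae (E 0) (c k 0) (case k of 0 \<Rightarrow> \<lambda>_. True | Suc i \<Rightarrow> L i 0)" for k
      by (cases k) (simp_all add: L ae_all[OF ext c_sup])
    from thread_exists[OF ext c_sup c_mono this]
    obtain s where s: "\<forall>k. s k \<in> points (E 0) (c k 0) \<and>
        (case k of 0 \<Rightarrow> \<lambda>_. True | Suc i \<Rightarrow> L i 0) (s k) \<and>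
        s k = proj (c (Suc k) 0) (c k 0) (s (Suc k))" ..
    have "L k 0 (s (Suc k))" for k using s[THEN spec, of "Suc k"] unfolding nat.case(2) by blast
    with s have "branch 0 s" unfolding branch_def by blast
    then show ?thesis by (rule exI[of _ s])
  qed
  have branch_Suc: "\<exists>t. branch (Suc n) t \<and> e (Suc n) (t 0) \<in> elts (e n (s 0))"
    if s: "branch n s" for n s
  proof -
    have s1: "s k \<in> points (E n) (c k n)" and s2: "s k = proj (c (Suc k) n) (c k n) (s (Suc k))"
      and s3: "L k n (s (Suc k))" for k using s unfolding branch_def by blast+
    \<comment> \<open>All members of the thread restrict to \<open>s 0\<close>, so every instance of
      \<open>step\<close> uses the same values of \<open>r n\<close> and \<open>e n\<close>.\<close>
    have s0: "proj (c k n) (c 0 n) (s k) = s 0" for k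
      using proj_thread[OF ext c_sup c_mono s1 s2, of "c 0 n" 0 k] proj_same[OF ext c_sup s1, of 0]
      by simp
    have "realizes_chains (r n (s 0))" using s3[of 0] s0[of 1] unfolding L_0 by simp
    moreover have "\<exists>D. kpair (CC k (Suc n) (L k (Suc n)) (e n (s 0))) D \<in> elts (r n (s 0)) \<and>
        kpair (h k n (s (Suc k))) (h (Suc k) n (s (Suc (Suc k)))) \<in> elts D" for k
      using s3[of "Suc k"] unfolding L_Suc step_def s0 s2[of "Suc k", symmetric] .
    ultimately have "\<exists>u. \<forall>k. kpair (u k) (u (Suc k)) \<in> elts (CC k (Suc n) (L k (Suc n)) (e n (s 0)))"
      unfolding realizes_chains_def
      by (elim allE[of _ "\<lambda>k. CC k (Suc n) (L k (Suc n)) (e n (s 0))"]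
          allE[of _ "\<lambda>k. h k n (s (Suc k))"] mp) (rule allI)
    then obtain u where u: "\<And>k. kpair (u k) (u (Suc k))
        \<in> elts (CC k (Suc n) (L k (Suc n)) (e n (s 0)))" by blast
    define t where "t k = elts (u k)" for k
    have t: "t (Suc k) \<in> points (E (Suc n)) (c (Suc k) (Suc n)) \<and> L k (Suc n) (t (Suc k)) \<and>
        t k = proj (c (Suc k) (Suc n)) (c k (Suc n)) (t (Suc k)) \<and>
        e (Suc n) (proj (c (Suc k) (Suc n)) (c 0 (Suc n)) (t (Suc k))) \<in> elts (e n (s 0))" for k
    proof -
      obtain w where w: "u k = vset (proj (c (Suc k) (Suc n)) (c k (Suc n)) w)" "u (Suc k) = vset w"
          "w \<in> points (E (Suc n)) (c (Suc k) (Suc n))" "L k (Suc n) w"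
          "e (Suc n) (proj (c (Suc k) (Suc n)) (c 0 (Suc n)) w) \<in> elts (e n (s 0))"
        using u[of k] unfolding elts_CC by auto
      have "t (Suc k) = w" unfolding t_def w(2) by (rule elts_vset[OF points_small[OF ext w(3)]])
      moreover have "t k = proj (c (Suc k) (Suc n)) (c k (Suc n)) w"
        unfolding t_def w(1)
        by (rule elts_vset[OF points_small[OF ext points_proj[OF ext c_sup w(3) sub]]]) simp
      ultimately show ?thesis using w(3-5) by simp
    qed
    have "t k \<in> points (E (Suc n)) (c k (Suc n))" for k
    proof -
      have "proj (c (Suc k) (Suc n)) (c k (Suc n)) (t (Suc k)) \<in> points (E (Suc n)) (c k (Suc n))"
        using t[of k] by (intro points_proj[OF ext c_sup _ sub]) simp_all
      moreover have "t k = proj (c (Suc k) (Suc n)) (c k (Suc n)) (t (Suc k))" using t[of k] by blast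
      ultimately show ?thesis by simp
    qed
    with t have "branch (Suc n) t" unfolding branch_def by blast
    moreover have "t 0 = proj (c (Suc 0) (Suc n)) (c 0 (Suc n)) (t (Suc 0))" using t[of 0] by blast
    then have "e (Suc n) (t 0) \<in> elts (e n (s 0))" using t[of 0] by simp
    ultimately show ?thesis by blast
  qed
  \<comment> \<open>Dependent choice iterates the passage to the next level; the ordinals read off
    at the first members of the threads descend.\<close>
  have "\<exists>s. \<forall>n. branch n (s n) \<and> e (Suc n) (s (Suc n) 0) \<in> elts (e n (s n 0))"
    by (rule dependent_nat_choice[where P = branch and
          Q = "\<lambda>n s t. e (Suc n) (t 0) \<in> elts (e n (s 0))"])
      (rule branch_0, rule branch_Suc)
  then obtain s where s: "\<forall>n. branch n (s n) \<and> e (Suc n) (s (Suc n) 0) \<in> elts (e n (s n 0))" ..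
  obtain n where "e (Suc n) (s (Suc n) 0) \<notin> elts (e n (s n 0))"
    using no_descending_chain[OF ext, where x = "\<lambda>n. e n (s n 0)"] ..
  then show False using s[THEN spec, THEN conjunct2, of n] by (rule notE)
qed

theorem mainTheorem5:
  fixes \<alpha> :: "'v::zfc_universe"
  assumes "ordinal \<alpha>"
  shows "(\<nexists>E :: nat \<Rightarrow> 'v ext_system. \<forall>n.
            extender (E n) \<and> discontinuous_at (E n) \<alpha> \<and> internal (E (Suc n)) (E n))
       \<and> wfp_on {E :: 'v ext_system. extender E \<and> discontinuous_at E \<alpha>} internal"
proof
  have no: False if E: "\<forall>n. extender (E n) \<and> discontinuous_at (E n) \<alpha> \<and> internal (E (Suc n)) (E n)"
    for E :: "nat \<Rightarrow> 'v ext_system"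
  proof (rule no_discontinuous_internal_chain[where E = E and \<alpha> = \<alpha>])
    show "extender (E n)" for n by (rule E[THEN spec, THEN conjunct1])
    show "discontinuous_at (E n) \<alpha>" for n by (rule E[THEN spec, THEN conjunct2, THEN conjunct1])
    show "internal (E (Suc n)) (E n)" for n by (rule E[THEN spec, THEN conjunct2, THEN conjunct2])
  qed
  show "\<nexists>E :: nat \<Rightarrow> 'v ext_system. \<forall>n.
      extender (E n) \<and> discontinuous_at (E n) \<alpha> \<and> internal (E (Suc n)) (E n)"
  proof
    assume "\<exists>E :: nat \<Rightarrow> 'v ext_system. \<forall>n.
      extender (E n) \<and> discontinuous_at (E n) \<alpha> \<and> internal (E (Suc n)) (E n)"
    then show False by (rule exE) (rule no)
  qed
  show "wfp_on {E :: 'v ext_system. extender E \<and> discontinuous_at E \<alpha>} internal"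
  \<comment> \<open>Relativized wellfoundedness becomes wellfoundedness of the relation restricted
    on both sides, whose infinite descents are the sequences already excluded.\<close>
  proof (rule wfp_on_iff_wfp[THEN iffD2], unfold wfp_def wf_iff_no_infinite_down_chain, rule notI)
    assume "\<exists>E. \<forall>n. (E (Suc n), E n) \<in> {(x, y). internal x y \<and>
      x \<in> {E :: 'v ext_system. extender E \<and> discontinuous_at E \<alpha>} \<and>
      y \<in> {E. extender E \<and> discontinuous_at E \<alpha>}}"
    then obtain E where "\<forall>n. (E (Suc n), E n) \<in> {(x, y). internal x y \<and>
      x \<in> {E :: 'v ext_system. extender E \<and> discontinuous_at E \<alpha>} \<and>
      y \<in> {E. extender E \<and> discontinuous_at E \<alpha>}}" ..
    then have "\<forall>n. extender (E n) \<and> discontinuous_at (E n) \<alpha> \<and> internal (E (Suc n)) (E n)"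
      by simp
    then show False by (rule no)
  qed
qed

end
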